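(* Let $\nu$ be a strict partition of $n$. Then $$\mathscr G^c_\nu(Z;\mathfrak q^{-1})=(-1)^n\,\mathfrak q^{-n}\,\mathscr G^c_\nu(Z;\mathfrak q).$$ Consequently, for every partition $\rho$ of $n$ all of whose parts are odd, $$\zeta^\nu_\rho(\mathfrak q)=\mathfrak q^{\,n-\ell(\rho)}\,\zeta^\nu_\rho(\mathfrak q^{-1}).$$ Moreover $\zeta^\nu_\rho(\mathfrak q)$ is a polynomial in $\mathfrak q$ of degree at most $n-\ell(\rho)$, and if $\zeta^\nu_\rho(\mathfrak q)=\sum_{i=0}^{n-\ell(\rho)}a_i\mathfrak q^i$ (some top coefficients possibly zero), then $a_i=a_{n-\ell(\rho)-i}$ for $0\le i\le n-\ell(\rho)$.
   Context: $\mathfrak q$ is an indeterminate. $\mathscr A_1$ is the set of finitely supported sequences $\alpha=(\alpha_1,\alpha_2,\dots)$ of nonnegative integers; $Z^\alpha=\prod_jz_j^{\alpha_j}$, $\ell(\alpha)=\#\{j:\alpha_j>0\}$. Let $\sum_{n\ge0}q_n(X)z^n=\prod_i\frac{1+x_iz}{1-x_iz}$, let $Q_\nu$ ($\nu$ strict) be the Schur $Q$-functions, $\tilde q_n=\frac1{\mathfrak q-1}q_n$ for $n\ge1$, and $\delta(\nu)\in\{0,1\}$ with $\delta(\nu)\equiv\ell(\nu)\pmod2$. $f[(\mathfrak q-1)X]$ denotes the substitution $p_r\mapsto(\mathfrak q^r-1)p_r(X)$. The coefficients $\zeta^\nu_\alpha(\mathfrak q)$ are defined by $$\prod_{j:\alpha_j>0}\tilde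 q_{\alpha_j}[(\mathfrak q-1)X]=\sum_{\nu\text{ strict}}2^{-\frac{\ell(\nu)+\delta(\nu)}2}\,\zeta^\nu_\alpha(\mathfrak q)\,Q_\nu(X);$$ when $\alpha=\rho$ is a partition of $n$ with all parts odd, $\zeta^\nu_\rho(\mathfrak q)$ is the value of the irreducible character of the Hecke--Clifford algebra labelled $\nu$ on the standard element $T_{\sigma_\rho}$. The generating function is $\mathscr G^c_\nu(Z;\mathfrak q)=\sum_{\alpha\in\mathscr A_1}(\mathfrak q-1)^{\ell(\alpha)}\zeta^\nu_\alpha(\mathfrak q)Z^\alpha$; replacing $\mathfrak q$ by $\mathfrak q^{-1}$ is applied to all coefficients. *)

theory Defs
  imports
    "HOL-Computational_Algebra.Computational_Algebra"
    "HOL-Computational_Algebra.Field_as_Ring"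
    "HOL-Library.Poly_Mapping"
begin

section \<open>Formal power series in countably many variables\<close>

text \<open>
  A monomial $\prod_j x_j^{\alpha_j}$ is its exponent vector, a finitely supported function
  on \<open>nat\<close>. Sequences which are indexed from 1 on paper are indexed from 0 here, so the
  exponent vectors are exactly the finitely supported sequences of nonnegative integers.
\<close>

type_synonym expvec = "nat \<Rightarrow>\<^sub>0 nat"

typedef 'a mps = "UNIV :: (expvec \<Rightarrow> 'a) set"
  morphisms mps_coeff Abs_mps ..

setup_lifting type_definition_mps

lemma mps_coeff_Abs_mps [simp]: "mps_coeff (Abs_mps f) = f"
  by (simp add: Abs_mps_inverse)

lemma mps_eqI: "(\<And>\<alpha>. mps_coeff f \<alpha> = mps_coeff g \<alpha>) \<Longrightarrow> f = g"
  using mps_coeff_inject by blast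

definition expvec_splits :: "expvec \<Rightarrow> (expvec \<times> expvec) set" where
  "expvec_splits \<gamma> = {(\<alpha>, \<beta>). \<alpha> + \<beta> = \<gamma>}"

lemma finite_expvec_splits [simp, intro]: "finite (expvec_splits \<gamma>)"
proof -
  let ?K = "Poly_Mapping.keys \<gamma>"
  define M where "M = Max (insert 0 (Poly_Mapping.lookup \<gamma> ` ?K))"
  let ?F = "{f :: nat \<Rightarrow> nat. \<forall>x. (x \<in> ?K \<longrightarrow> f x \<in> {..M}) \<and> (x \<notin> ?K \<longrightarrow> f x = 0)}"
  have fin: "finite ?F"
    by (rule finite_set_of_finite_funs) auto
  have le: "Poly_Mapping.lookup \<gamma> x \<le> M" if "x \<in> ?K" for x
    unfolding M_def using that by (intro Max_ge) auto
  have "Poly_Mapping.lookup ` {\<alpha>. \<exists>\<beta>. \<alpha> + \<beta> = \<gamma>} \<subseteq> ?F"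
  proof clarify
    fix \<alpha> \<beta> :: expvec and x :: nat
    assume *: "\<gamma> = \<alpha> + \<beta>"
    have "Poly_Mapping.lookup \<alpha> x \<le> Poly_Mapping.lookup (\<alpha> + \<beta>) x"
      by (simp add: lookup_add)
    then show "(x \<in> Poly_Mapping.keys (\<alpha> + \<beta>) \<longrightarrow> Poly_Mapping.lookup \<alpha> x \<in> {..M}) \<and>
               (x \<notin> Poly_Mapping.keys (\<alpha> + \<beta>) \<longrightarrow> Poly_Mapping.lookup \<alpha> x = 0)"
      using le[of x] * by (auto simp: in_keys_iff)
  qed
  then have "finite {\<alpha>. \<exists>\<beta>. \<alpha> + \<beta> = \<gamma>}"
    by (rule finite_imageD [OF finite_subset [OF _ fin]])
       (auto intro!: inj_onI poly_mapping_eqI simp: fun_eq_iff)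
  moreover have "expvec_splits \<gamma> \<subseteq> {\<alpha>. \<exists>\<beta>. \<alpha> + \<beta> = \<gamma>} \<times> {\<alpha>. \<exists>\<beta>. \<alpha> + \<beta> = \<gamma>}"
    by (auto simp: expvec_splits_def) (metis add.commute)
  ultimately show ?thesis
    by (meson finite_SigmaI finite_subset)
qed

instantiation mps :: (comm_ring_1) comm_ring_1
begin

lift_definition zero_mps :: "'a mps" is "\<lambda>_. 0" .
lift_definition one_mps :: "'a mps" is "\<lambda>\<gamma>. if \<gamma> = 0 then 1 else 0" .
lift_definition plus_mps :: "'a mps \<Rightarrow> 'a mps \<Rightarrow> 'a mps" is "\<lambda>f g \<gamma>. f \<gamma> + g \<gamma>" .
lift_definition uminus_mps :: "'a mps \<Rightarrow> 'a mps" is "\<lambda>f \<gamma>. - f \<gamma>" .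
lift_definition minus_mps :: "'a mps \<Rightarrow> 'a mps \<Rightarrow> 'a mps" is "\<lambda>f g \<gamma>. f \<gamma> - g \<gamma>" .
lift_definition times_mps :: "'a mps \<Rightarrow> 'a mps \<Rightarrow> 'a mps" is
  "\<lambda>f g \<gamma>. \<Sum>(\<alpha>, \<beta>) \<in> expvec_splits \<gamma>. f \<alpha> * g \<beta>" .

instance
proof
  fix a b c :: "'a mps"
  show "a * b * c = a * (b * c)"
  proof (transfer, rule ext)
    fix f g h :: "expvec \<Rightarrow> 'a" and \<gamma>
    have "(\<Sum>(\<alpha>, \<beta>) \<in> expvec_splits \<gamma>.
             (\<Sum>(\<alpha>', \<beta>') \<in> expvec_splits \<alpha>. f \<alpha>' * g \<beta>') * h \<beta>) =
          (\<Sum>(p, p') \<in> Sigma (expvec_splits \<gamma>) (\<lambda>p. expvec_splits (fst p)).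
             f (fst p') * g (snd p') * h (snd p))"
      by (subst sum.Sigma [symmetric]) (auto simp: sum_distrib_right case_prod_unfold)
    also have "\<dots> = (\<Sum>(p, p') \<in> Sigma (expvec_splits \<gamma>) (\<lambda>p. expvec_splits (snd p)).
             f (fst p) * (g (fst p') * h (snd p')))"
      by (rule sum.reindex_bij_witness
            [where i = "\<lambda>(p, p'). ((fst p + fst p', snd p'), (fst p, fst p'))"
               and j = "\<lambda>(p, p'). ((fst p', snd p' + snd p), (snd p', snd p))"])
         (auto simp: expvec_splits_def algebra_simps)
    also have "\<dots> = (\<Sum>(\<alpha>, \<beta>) \<in> expvec_splits \<gamma>.
             f \<alpha> * (\<Sum>(\<alpha>', \<beta>') \<in> expvec_splits \<beta>. g \<alpha>' * h \<beta>'))"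
      by (subst sum.Sigma [symmetric]) (auto simp: sum_distrib_left case_prod_unfold)
    finally show "(\<Sum>(\<alpha>, \<beta>) \<in> expvec_splits \<gamma>.
             (\<Sum>(\<alpha>', \<beta>') \<in> expvec_splits \<alpha>. f \<alpha>' * g \<beta>') * h \<beta>) =
          (\<Sum>(\<alpha>, \<beta>) \<in> expvec_splits \<gamma>.
             f \<alpha> * (\<Sum>(\<alpha>', \<beta>') \<in> expvec_splits \<beta>. g \<alpha>' * h \<beta>'))" .
  qed
  show "a * b = b * a"
  proof (transfer, rule ext)
    fix f g :: "expvec \<Rightarrow> 'a" and \<gamma>
    show "(\<Sum>(\<alpha>, \<beta>) \<in> expvec_splits \<gamma>. f \<alpha> * g \<beta>) = (\<Sum>(\<alpha>, \<beta>) \<in> expvec_splits \<gamma>. g \<alpha> * f \<beta>)"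
      by (rule sum.reindex_bij_witness [where i = prod.swap and j = prod.swap])
         (auto simp: expvec_splits_def algebra_simps)
  qed
  show "1 * a = a"
  proof (transfer, rule ext)
    fix f :: "expvec \<Rightarrow> 'a" and \<gamma>
    have "(\<Sum>(\<alpha>, \<beta>) \<in> expvec_splits \<gamma>. (if \<alpha> = 0 then 1 else 0) * f \<beta>) =
          (\<Sum>(\<alpha>, \<beta>) \<in> {(0 :: expvec, \<gamma>)}. (if \<alpha> = 0 then 1 else 0) * f \<beta>)"
      by (rule sum.mono_neutral_right [OF finite_expvec_splits])
         (auto simp: expvec_splits_def split: if_splits)
    then show "(\<Sum>(\<alpha>, \<beta>) \<in> expvec_splits \<gamma>. (if \<alpha> = 0 then 1 else 0) * f \<beta>) = f \<gamma>"
      by simp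
  qed
  show "(a + b) * c = a * c + b * c"
    by (transfer, rule ext) (simp add: algebra_simps sum.distrib case_prod_unfold)
  show "(0 :: 'a mps) \<noteq> 1"
    by transfer (metis zero_neq_one)
qed (transfer; simp add: fun_eq_iff algebra_simps)+

end

definition mps_const :: "'a \<Rightarrow> 'a::zero mps" where
  "mps_const c = Abs_mps (\<lambda>\<alpha>. if \<alpha> = 0 then c else 0)"

definition mps_map :: "('a \<Rightarrow> 'b) \<Rightarrow> 'a mps \<Rightarrow> 'b mps" where
  "mps_map h f = Abs_mps (\<lambda>\<alpha>. h (mps_coeff f \<alpha>))"

definition expvec_size :: "expvec \<Rightarrow> nat" where
  "expvec_size \<alpha> = (\<Sum>j\<in>Poly_Mapping.keys \<alpha>. Poly_Mapping.lookup \<alpha> j)"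

definition expvec_len :: "expvec \<Rightarrow> nat" where
  "expvec_len \<alpha> = card (Poly_Mapping.keys \<alpha>)"


section \<open>The coefficient field\<close>

type_synonym ratfun = "rat poly fract"

definition ratfun_const :: "rat \<Rightarrow> ratfun" where
  "ratfun_const c = to_fract [:c:]"

definition \<qq> :: ratfun where
  "\<qq> = to_fract [:0, 1:]"

text \<open>
  The substitution of \<open>inverse \<qq>\<close> for \<open>\<qq>\<close>, performed in numerator and denominator of the
  reduced fraction.
\<close>

definition invert_q :: "ratfun \<Rightarrow> ratfun" where
  "invert_q f = (let (a, b) = quot_of_fract f in
     poly (map_poly ratfun_const a) (inverse \<qq>) / poly (map_poly ratfun_const b) (inverse \<qq>))"


section \<open>Power sums and the functions \<open>q\<^sub>n\<close>\<close>

text \<open>Only meaningful for \<open>r > 0\<close>.\<close>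

definition psum :: "nat \<Rightarrow> 'a::comm_ring_1 mps" where
  "psum r = Abs_mps (\<lambda>\<alpha>. if \<exists>i. \<alpha> = Poly_Mapping.single i r then 1 else 0)"

text \<open>
  The coefficient of $x^\alpha z^n$ in $\prod_i f(x_i z)$, for a power series $f$ in one variable
  with constant term 1, is $\prod_i [y^{\alpha_i}] f$ if $|\alpha| = n$ and 0 otherwise. Here
  $f = (1 + y) / (1 - y)$.
\<close>

definition qfun :: "nat \<Rightarrow> ratfun mps" where
  "qfun n = Abs_mps (\<lambda>\<alpha>. if expvec_size \<alpha> = n
     then \<Prod>i\<in>Poly_Mapping.keys \<alpha>.
            fps_nth ((1 + fps_X) / (1 - fps_X)) (Poly_Mapping.lookup \<alpha> i)
     else 0)"

definition qfun_tilde :: "nat \<Rightarrow> ratfun mps" where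
  "qfun_tilde n = mps_const (1 / (\<qq> - 1)) * qfun n"

text \<open>
  A polynomial in the power sums is an element \<open>F\<close> of \<open>(nat \<Rightarrow>\<^sub>0 nat) \<Rightarrow>\<^sub>0 ratfun\<close>, in which the
  variable with index \<open>i\<close> stands for $p_{i+1}$. Every symmetric function (of bounded degree) is \<open>psum_poly psum F\<close>
  for exactly one \<open>F\<close>.
\<close>

definition psum_poly :: "(nat \<Rightarrow> ratfun mps) \<Rightarrow> (expvec \<Rightarrow>\<^sub>0 ratfun) \<Rightarrow> ratfun mps" where
  "psum_poly u F = (\<Sum>m\<in>Poly_Mapping.keys F. mps_const (Poly_Mapping.lookup F m) *
     (\<Prod>i\<in>Poly_Mapping.keys m. u (Suc i) ^ Poly_Mapping.lookup m i))"

text \<open>\<open>pleth f\<close> is $f[(\mathfrak q - 1)X]$. The substitution is linear over \<open>ratfun\<close>: it leaves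
  the coefficients alone.\<close>

definition pleth :: "ratfun mps \<Rightarrow> ratfun mps" where
  "pleth f = psum_poly (\<lambda>r. mps_const (\<qq> ^ r - 1) * psum r) (THE F. psum_poly psum F = f)"


section \<open>Partitions and Schur's \<open>Q\<close>-functions\<close>

definition strict_partition :: "nat list \<Rightarrow> bool" where
  "strict_partition \<nu> \<longleftrightarrow> sorted_wrt (>) \<nu> \<and> 0 \<notin> set \<nu>"

definition odd_partition :: "nat list \<Rightarrow> bool" where
  "odd_partition \<rho> \<longleftrightarrow> sorted_wrt (\<ge>) \<rho> \<and> (\<forall>r\<in>set \<rho>. odd r)"

text \<open>The Pfaffian of the skew-symmetric matrix with rows and columns indexed by a list, by
  expansion along the first row. Only the entries above the diagonal are used.\<close>

function pfaffian :: "('i \<Rightarrow> 'i \<Rightarrow> 'a::comm_ring_1) \<Rightarrow> 'i list \<Rightarrow> 'a" where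
  "pfaffian A [] = 1"
| "pfaffian A (x # xs) = (\<Sum>j<length xs.
     (-1) ^ j * A x (xs ! j) * pfaffian A (take j xs @ drop (Suc j) xs))"
  by pat_completeness auto
termination
  by (relation "measure (\<lambda>(A, xs). length xs)") auto

text \<open>Schur's definition: first $Q_{(r,s)}$ for $r > s \ge 0$ (so that $Q_{(r,0)} = q_r$), then
  $Q_\nu$ as the Pfaffian of the matrix of all $Q_{(\nu_i,\nu_j)}$, where a part 0 is appended
  to \<open>\<nu>\<close> if its length is odd.\<close>

definition Qfun2 :: "nat \<Rightarrow> nat \<Rightarrow> ratfun mps" where
  "Qfun2 r s = qfun r * qfun s + 2 * (\<Sum>i=1..s. (-1) ^ i * (qfun (r + i) * qfun (s - i)))"

definition Qfun :: "nat list \<Rightarrow> ratfun mps" where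
  "Qfun \<nu> = pfaffian Qfun2 (if even (length \<nu>) then \<nu> else \<nu> @ [0])"


section \<open>The coefficients \<open>\<zeta>\<close> and their generating function\<close>

definition parity_len :: "nat list \<Rightarrow> nat" where
  "parity_len \<nu> = length \<nu> mod 2"

text \<open>The family $(\zeta^\nu_\alpha)_\nu$ for fixed \<open>\<alpha>\<close>, as a finitely supported function on
  the strict partitions. The exponent of 2 is an integer, as \<open>length \<nu> + parity_len \<nu>\<close> is even.\<close>

definition zeta_family :: "expvec \<Rightarrow> (nat list \<Rightarrow>\<^sub>0 ratfun)" where
  "zeta_family \<alpha> = (THE c. (\<forall>\<nu>\<in>Poly_Mapping.keys c. strict_partition \<nu>) \<and>
     (\<Prod>j\<in>Poly_Mapping.keys \<alpha>. pleth (qfun_tilde (Poly_Mapping.lookup \<alpha> j))) =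
     (\<Sum>\<nu>\<in>Poly_Mapping.keys c.
        mps_const (1 / 2 ^ ((length \<nu> + parity_len \<nu>) div 2) * Poly_Mapping.lookup c \<nu>) * Qfun \<nu>))"

definition zeta :: "nat list \<Rightarrow> expvec \<Rightarrow> ratfun" where
  "zeta \<nu> \<alpha> = Poly_Mapping.lookup (zeta_family \<alpha>) \<nu>"

text \<open>\<open>Poly_Mapping.nth \<rho>\<close> is the list \<open>\<rho>\<close> continued by zeros.\<close>

abbreviation zeta_part :: "nat list \<Rightarrow> nat list \<Rightarrow> ratfun" where
  "zeta_part \<nu> \<rho> \<equiv> zeta \<nu> (Poly_Mapping.nth \<rho>)"

text \<open>A power series in the variables $z_j$.\<close>

definition Gc :: "nat list \<Rightarrow> ratfun mps" where
  "Gc \<nu> = Abs_mps (\<lambda>\<alpha>. (\<qq> - 1) ^ expvec_len \<alpha> * zeta \<nu> \<alpha>)"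

end

theory Submission
  imports Defs "HOL-Library.Nat_Bijection"
begin

text \<open>
  Put \<open>H(z) = \<Sum> q\<^sub>n z^n\<close>. The substitution \<open>p\<^sub>r \<mapsto> (\<qq>^r - 1) p\<^sub>r\<close> turns \<open>H(z)\<close> into
  \<open>H(\<qq> z) / H(z) = H(\<qq> z) H(-z)\<close>, whose coefficient at \<open>z^n\<close> is the sum of all
  \<open>(-1)^j \<qq>^i q\<^sub>i q\<^sub>j\<close> with \<open>i + j = n\<close>. Inverting \<open>\<qq>\<close> exchanges \<open>i\<close> and \<open>j\<close>, up to the factor
  \<open>(-1)^n \<qq>^(-n)\<close>. As the \<open>Q\<^sub>\<nu>\<close> have rational coefficients and are linearly independent over the
  rational functions, the expansion coefficients inherit this symmetry. Moreover the coefficient of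
  \<open>z^n\<close> vanishes at \<open>\<qq> = 1\<close>, and products of the \<open>q\<^sub>n\<close> are integral combinations of the \<open>Q\<^sub>\<nu>\<close>, so
  the \<open>\<zeta>\<close> are polynomials; the bound on the degree then follows from the symmetry.
\<close>

section \<open>Coefficients and ring homomorphisms\<close>

text \<open>Both \<open>pleth\<close> and \<open>zeta_family\<close> are definite descriptions, so
  they can be evaluated only once uniqueness is known: for polynomials in the power sums by
  comparing leading monomials, for expansions in the \<open>Q\<^sub>\<nu>\<close> by linear
  independence. That independence is obtained by counting: the independent products of odd power
  sums, as many as there are strict partitions, lie in the span of the \<open>Q\<^sub>\<nu>\<close>.

  The value of the substitution at \<open>q\<^sub>n\<close> comes from recursions instead of
  exponentials and logarithms. With P(z) = 2 (p_1 z + p_3 z^3 + ...), the logarithmic derivatives of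
  H(z) and H(\<qq> z) H(-z) with respect to z d/dz are P(z) and P(\<qq> z) - P(z); the resulting
  Newton recursions are carried into each other by the substitution.

  Products of \<open>q\<^sub>n\<close> are straightened into \<open>Q\<^sub>\<nu>\<close> over a
  coefficient ring that is left open. All rational functions are taken for the independence, the
  polynomials in \<qq> for the polynomiality of \<zeta>.\<close>

lemma mps_coeff_simps [simp]:
  "mps_coeff 0 \<gamma> = 0"
  "mps_coeff 1 \<gamma> = (if \<gamma> = 0 then 1 else 0)"
  "mps_coeff (f + g) \<gamma> = mps_coeff f \<gamma> + mps_coeff g \<gamma>"
  "mps_coeff (f - g) \<gamma> = mps_coeff f \<gamma> - mps_coeff g \<gamma>"
  "mps_coeff (- f) \<gamma> = - mps_coeff f \<gamma>"
  by (simp_all add: zero_mps.rep_eq one_mps.rep_eq plus_mps.rep_eq minus_mps.rep_eq uminus_mps.rep_eq)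

lemma mps_coeff_mult:
  "mps_coeff (f * g) \<gamma> = (\<Sum>(\<alpha>, \<beta>) \<in> expvec_splits \<gamma>. mps_coeff f \<alpha> * mps_coeff g \<beta>)"
  by transfer simp

lemma mps_coeff_sum [simp]: "mps_coeff (sum f A) \<gamma> = (\<Sum>i\<in>A. mps_coeff (f i) \<gamma>)"
  by (induction A rule: infinite_finite_induct) auto

lemma mps_coeff_const_mult [simp]: "mps_coeff (mps_const c * f) \<gamma> = c * mps_coeff f \<gamma>"
proof -
  have "mps_coeff (mps_const c * f) \<gamma> =
      (\<Sum>(\<alpha>, \<beta>) \<in> {(0 :: expvec, \<gamma>)}. (if \<alpha> = 0 then c else 0) * mps_coeff f \<beta>)"
    unfolding mps_coeff_mult mps_const_def mps_coeff_Abs_mps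
    by (rule sum.mono_neutral_right [OF finite_expvec_splits])
       (auto simp: expvec_splits_def split: if_splits)
  then show ?thesis by simp
qed

lemma mps_const_0 [simp]: "mps_const 0 = 0"
  by (rule mps_eqI) (simp add: mps_const_def)

lemma mps_const_1 [simp]: "mps_const 1 = 1"
  by (rule mps_eqI) (simp add: mps_const_def)

lemma mps_const_add: "mps_const (a + b) = mps_const a + mps_const b"
  for a b :: "'a::comm_ring_1"
  by (rule mps_eqI) (simp add: mps_const_def)

lemma mps_const_diff: "mps_const (a - b) = mps_const a - mps_const b"
  for a b :: "'a::comm_ring_1"
  by (rule mps_eqI) (simp add: mps_const_def)

lemma mps_const_minus: "mps_const (- a) = - mps_const a"
  for a :: "'a::comm_ring_1"
  by (rule mps_eqI) (simp add: mps_const_def)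

lemma mps_const_mult: "mps_const (a * b) = mps_const a * mps_const b"
  for a b :: "'a::comm_ring_1"
  by (rule mps_eqI) (simp, simp add: mps_const_def)

lemma mps_const_power: "mps_const (a ^ n) = mps_const a ^ n"
  for a :: "'a::comm_ring_1"
  by (induction n) (simp_all add: mps_const_mult)

lemma mps_const_prod: "mps_const (prod f A) = (\<Prod>x\<in>A. mps_const (f x))"
  for f :: "'b \<Rightarrow> 'a::comm_ring_1"
  by (induction A rule: infinite_finite_induct) (simp_all add: mps_const_mult)

lemma mps_const_of_nat: "mps_const (of_nat n) = (of_nat n :: 'a::comm_ring_1 mps)"
  by (induction n) (simp_all add: mps_const_add)

lemma mps_const_numeral [simp]: "mps_const (numeral n) = (numeral n :: 'a::comm_ring_1 mps)"
  using mps_const_of_nat [of "numeral n"] by simp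

lemma mps_const_cancel:
  fixes f g :: "'a::field mps"
  assumes "mps_const c * f = mps_const c * g" and "c \<noteq> 0"
  shows "f = g"
proof (rule mps_eqI)
  fix \<alpha>
  have "mps_coeff (mps_const c * f) \<alpha> = mps_coeff (mps_const c * g) \<alpha>"
    using assms(1) by simp
  then have "c * mps_coeff f \<alpha> = c * mps_coeff g \<alpha>"
    unfolding mps_coeff_const_mult .
  then show "mps_coeff f \<alpha> = mps_coeff g \<alpha>" using assms(2) by simp
qed

text \<open>One interface for \<open>eval_inv\<close>, \<open>invert_q\<close>, their
  coefficientwise extensions to power series, and the evaluations
  \<open>psum_poly u\<close>.\<close>

locale unital_ring_hom =
  fixes h :: "'a::comm_ring_1 \<Rightarrow> 'b::comm_ring_1"
  assumes hom_add: "h (a + b) = h a + h b"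
    and hom_mult: "h (a * b) = h a * h b"
    and hom_1: "h 1 = 1"
begin

lemma hom_0: "h 0 = 0"
  using hom_add [of 0 0] by simp

lemma hom_minus: "h (- a) = - h a"
  using hom_add [of a "- a"] by (simp add: hom_0 eq_neg_iff_add_eq_0 add.commute)

lemma hom_diff: "h (a - b) = h a - h b"
  using hom_add [of a "- b"] by (simp add: hom_minus)

lemma hom_sum: "h (sum f A) = (\<Sum>x\<in>A. h (f x))"
  by (induction A rule: infinite_finite_induct) (simp_all add: hom_0 hom_add)

lemma hom_prod: "h (prod f A) = (\<Prod>x\<in>A. h (f x))"
  by (induction A rule: infinite_finite_induct) (simp_all add: hom_1 hom_mult)

lemma hom_power: "h (a ^ n) = h a ^ n"
  by (induction n) (simp_all add: hom_1 hom_mult)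

lemma hom_of_nat: "h (of_nat n) = of_nat n"
  by (induction n) (simp_all add: hom_0 hom_1 hom_add)

lemma hom_numeral: "h (numeral n) = numeral n"
  using hom_of_nat [of "numeral n"] by simp

lemma hom_minus_one_power: "h ((-1) ^ n) = (-1) ^ n"
  by (simp add: hom_power hom_minus hom_1)

lemma mps_map_hom: "unital_ring_hom (mps_map h)"
proof
  fix a b :: "'a mps"
  show "mps_map h (a + b) = mps_map h a + mps_map h b"
    by (rule mps_eqI) (simp add: mps_map_def hom_add)
  show "mps_map h (a * b) = mps_map h a * mps_map h b"
    by (rule mps_eqI) (simp add: mps_map_def mps_coeff_mult hom_mult hom_sum case_prod_unfold)
  show "mps_map h 1 = 1"
    by (rule mps_eqI) (simp add: mps_map_def hom_0 hom_1)
qed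

lemma mps_map_const: "mps_map h (mps_const c) = mps_const (h c)"
  by (rule mps_eqI) (simp add: mps_map_def mps_const_def hom_0)

lemma hom_pfaffian: "h (pfaffian A xs) = pfaffian (\<lambda>i j. h (A i j)) xs"
proof (induction "length xs" arbitrary: xs rule: less_induct)
  case less
  show ?case
  proof (cases xs)
    case Nil
    then show ?thesis by (simp add: hom_1)
  next
    case (Cons y ys)
    have "h (pfaffian A (take j ys @ drop (Suc j) ys)) =
        pfaffian (\<lambda>i j. h (A i j)) (take j ys @ drop (Suc j) ys)" if "j < length ys" for j
      using that Cons by (intro less) auto
    then show ?thesis
      by (simp add: Cons hom_sum hom_mult hom_minus_one_power)
  qed
qed

end

section \<open>Substituting the inverse of \<qq>: polynomials, then fractions\<close>

definition eval_inv :: "rat poly \<Rightarrow> ratfun" where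
  "eval_inv p = poly (map_poly ratfun_const p) (inverse \<qq>)"

lemma ratfun_const_simps [simp]:
  "ratfun_const 0 = 0" "ratfun_const 1 = 1"
  "ratfun_const (a + b) = ratfun_const a + ratfun_const b"
  "ratfun_const (a * b) = ratfun_const a * ratfun_const b"
  by (simp_all add: ratfun_const_def flip: to_fract_add to_fract_mult one_pCons)

lemma to_fract_pow: "to_fract (p ^ n) = to_fract p ^ n"
  by (induction n) simp_all

lemma to_fract_conv_sum:
  "to_fract p = (\<Sum>i\<le>degree p. ratfun_const (coeff p i) * \<qq> ^ i)"
proof -
  have "to_fract p = to_fract (\<Sum>i\<le>degree p. [:coeff p i:] * [:0, 1:] ^ i)"
    by (subst (1) poly_as_sum_of_monoms [symmetric])
       (simp add: monom_altdef)
  then show ?thesis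
    by (simp only: ratfun_const_def \<qq>_def to_fract_pow to_fract_sum to_fract_mult)
qed

lemma q_nonzero [simp]: "\<qq> \<noteq> 0"
  by (simp add: \<qq>_def)

lemma q_minus_1_nonzero [simp]: "\<qq> - 1 \<noteq> 0" "\<qq> \<noteq> 1"
proof -
  show "\<qq> \<noteq> 1"
    unfolding \<qq>_def by (metis one_neq_zero pCons_eq_iff one_pCons to_fract_1 to_fract_eq_iff)
  then show "\<qq> - 1 \<noteq> 0" by simp
qed

lemma eval_inv_hom: "unital_ring_hom eval_inv"
proof
  fix a b :: "rat poly"
  have add: "map_poly ratfun_const (a + b) = map_poly ratfun_const a + map_poly ratfun_const b"
    for a b by (rule poly_eqI) (simp add: coeff_map_poly)
  have sum: "ratfun_const (sum f A) = (\<Sum>x\<in>A. ratfun_const (f x))" for f and A :: "nat set"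
    by (induction A rule: infinite_finite_induct) auto
  show "eval_inv (a + b) = eval_inv a + eval_inv b"
    by (simp add: eval_inv_def add)
  have "map_poly ratfun_const (a * b) = map_poly ratfun_const a * map_poly ratfun_const b"
    by (rule poly_eqI) (simp add: coeff_map_poly coeff_mult sum)
  then show "eval_inv (a * b) = eval_inv a * eval_inv b"
    by (simp add: eval_inv_def)
  show "eval_inv 1 = 1"
    by (simp add: eval_inv_def)
qed

interpretation eval_inv: unital_ring_hom eval_inv
  by (rule eval_inv_hom)

lemma eval_inv_conv_sum:
  assumes "degree p \<le> d"
  shows "eval_inv p = (\<Sum>i\<le>d. ratfun_const (coeff p i) * inverse \<qq> ^ i)"
proof -
  have "degree (map_poly ratfun_const p) \<le> d"
    using assms by (intro degree_le) (auto simp: coeff_map_poly coeff_eq_0)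
  then have "poly (map_poly ratfun_const p) x =
      (\<Sum>i\<le>d. coeff (map_poly ratfun_const p) i * x ^ i)" for x
    unfolding poly_altdef
    by (intro sum.mono_neutral_left) (auto simp: coeff_eq_0)
  then show ?thesis
    by (simp add: eval_inv_def coeff_map_poly)
qed

text \<open>Multiplication by \<open>\<qq> ^ d\<close> reverses the coefficients with indices 0 to
  \<open>d\<close>. Any bound \<open>d\<close> on the degree is allowed, so the reversal may be
  padded with zeros.\<close>

lemma power_mult_eval_inv:
  assumes "degree p \<le> d"
  shows "\<qq> ^ d * eval_inv p = (\<Sum>i\<le>d. ratfun_const (coeff p (d - i)) * \<qq> ^ i)"
proof -
  have "\<qq> ^ d * eval_inv p = (\<Sum>i\<le>d. ratfun_const (coeff p i) * \<qq> ^ (d - i))"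
    unfolding eval_inv_conv_sum [OF assms] sum_distrib_left
    by (rule sum.cong) (auto simp: power_diff divide_simps power_inverse)
  also have "\<dots> = (\<Sum>i\<le>d. ratfun_const (coeff p (d - i)) * \<qq> ^ i)"
    by (rule sum.reindex_bij_witness [where i = "\<lambda>i. d - i" and j = "\<lambda>i. d - i"]) auto
  finally show ?thesis .
qed

lemma to_fract_conv_sum_le:
  assumes "degree p \<le> d"
  shows "to_fract p = (\<Sum>i\<le>d. ratfun_const (coeff p i) * \<qq> ^ i)"
  unfolding to_fract_conv_sum
  using assms by (intro sum.mono_neutral_left) (auto simp: coeff_eq_0)

lemma power_mult_eval_inv_reflect:
  "\<qq> ^ degree p * eval_inv p = to_fract (reflect_poly p)"
  unfolding power_mult_eval_inv [OF order.refl] to_fract_conv_sum_le [OF degree_reflect_poly_le]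
  by (rule sum.cong) (auto simp: coeff_reflect_poly)

text \<open>Reversing a nonzero polynomial gives a nonzero polynomial. Hence denominators stay
  nonzero when \<qq> is inverted.\<close>

lemma eval_inv_eq_0_iff [simp]: "eval_inv p = 0 \<longleftrightarrow> p = 0"
proof
  assume "eval_inv p = 0"
  then have "to_fract (reflect_poly p) = 0"
    by (simp flip: power_mult_eval_inv_reflect)
  then show "p = 0" by simp
qed (simp add: eval_inv.hom_0)

text \<open>Cross multiplication shows that the value does not depend on the reduced representative
  used in the definition; this is what makes \<open>invert_q\<close> a ring homomorphism.\<close>

lemma invert_q_Fract:
  assumes "b \<noteq> 0"
  shows "invert_q (Fract a b) = eval_inv a / eval_inv b"
proof -
  define c d where "c = fst (quot_of_fract (Fract a b))" and "d = snd (quot_of_fract (Fract a b))"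
  have d: "d \<noteq> 0" and "Fract c d = Fract a b"
    by (simp_all add: c_def d_def)
  then have "c * b = a * d"
    using assms by (simp add: eq_fract)
  then have "eval_inv c * eval_inv b = eval_inv a * eval_inv d"
    by (metis eval_inv.hom_mult)
  then have "eval_inv c / eval_inv d = eval_inv a / eval_inv b"
    using d assms by (simp add: frac_eq_eq)
  then show ?thesis
    by (simp add: invert_q_def c_def d_def eval_inv_def case_prod_unfold Let_def)
qed

lemma invert_q_to_fract: "invert_q (to_fract p) = eval_inv p"
  using invert_q_Fract [of 1 p] by (simp add: to_fract_def eval_inv.hom_1)

lemma invert_q_hom: "unital_ring_hom invert_q"
proof
  fix x y :: ratfun
  obtain a b where x: "x = Fract a b" "b \<noteq> 0" by (cases x)
  obtain c d where y: "y = Fract c d" "d \<noteq> 0" by (cases y)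
  show "invert_q (x + y) = invert_q x + invert_q y"
    using x y by (simp add: invert_q_Fract eval_inv.hom_add eval_inv.hom_mult add_frac_eq)
  show "invert_q (x * y) = invert_q x * invert_q y"
    using x y by (simp add: invert_q_Fract eval_inv.hom_mult)
  show "invert_q 1 = 1"
    using invert_q_to_fract [of 1] by (simp add: eval_inv.hom_1)
qed

interpretation invert_q: unital_ring_hom invert_q
  by (rule invert_q_hom)

interpretation invert_q_mps: unital_ring_hom "mps_map invert_q"
  by (rule invert_q.mps_map_hom)

lemma invert_q_q [simp]: "invert_q \<qq> = inverse \<qq>"
  unfolding \<qq>_def invert_q_to_fract
  by (simp add: eval_inv_def map_poly_pCons flip: \<qq>_def)

section \<open>Linear independence of the products of power sums\<close>

definition psum_mset :: "nat multiset \<Rightarrow> 'a::comm_ring_1 mps" where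
  "psum_mset M = (\<Prod>r\<in>#M. psum r)"

text \<open>The partition of the monomial symmetric function to which the monomial belongs.\<close>

definition expvec_parts :: "expvec \<Rightarrow> nat multiset" where
  "expvec_parts \<alpha> = image_mset (Poly_Mapping.lookup \<alpha>) (mset_set (Poly_Mapping.keys \<alpha>))"

lemma psum_mset_simps [simp]:
  "psum_mset {#} = 1"
  "psum_mset (add_mset r M) = psum r * psum_mset M"
  "psum_mset (M + N) = psum_mset M * psum_mset N"
  by (simp_all add: psum_mset_def)

lemma size_expvec_parts [simp]: "size (expvec_parts \<alpha>) = card (Poly_Mapping.keys \<alpha>)"
  by (simp add: expvec_parts_def)

lemma keys_single_add:
  assumes "0 < (r::nat)"
  shows "Poly_Mapping.keys (Poly_Mapping.single i r + \<beta>) = insert i (Poly_Mapping.keys \<beta>)"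
  using assms by (auto simp: in_keys_iff lookup_add lookup_single when_def split: if_splits)

lemma expvec_parts_single_add:
  assumes "0 < r" and "i \<notin> Poly_Mapping.keys \<beta>"
  shows "expvec_parts (Poly_Mapping.single i r + \<beta>) = add_mset r (expvec_parts \<beta>)"
proof -
  have "image_mset (Poly_Mapping.lookup (Poly_Mapping.single i r + \<beta>)) (mset_set (Poly_Mapping.keys \<beta>)) =
      image_mset (Poly_Mapping.lookup \<beta>) (mset_set (Poly_Mapping.keys \<beta>))"
    using assms by (intro image_mset_cong) (auto simp: lookup_add lookup_single when_def)
  moreover have "Poly_Mapping.lookup \<beta> i = 0"
    using assms by (simp add: in_keys_iff)
  ultimately show ?thesis
    using assms by (simp add: expvec_parts_def keys_single_add lookup_add)
qed

lemma psum_single: "mps_coeff (psum r) (Poly_Mapping.single i r) = 1"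
  unfolding psum_def mps_coeff_Abs_mps by auto

text \<open>As \<open>psum r\<close> is the sum of all r-th powers of variables, the factor takes
  \<open>r\<close> away from the exponent of a single variable.\<close>

lemma mps_coeff_psum_mult:
  assumes "0 < r"
  shows "mps_coeff (psum r * f) \<gamma> =
    (\<Sum>i | r \<le> Poly_Mapping.lookup \<gamma> i. mps_coeff f (\<gamma> - Poly_Mapping.single i r))"
proof -
  let ?I = "{i. r \<le> Poly_Mapping.lookup \<gamma> i}"
  let ?g = "\<lambda>i. (Poly_Mapping.single i r, \<gamma> - Poly_Mapping.single i r)"
  have sub: "Poly_Mapping.single i r + (\<gamma> - Poly_Mapping.single i r) = \<gamma>" if "i \<in> ?I" for i
    using that by (intro poly_mapping_eqI) (auto simp: lookup_add lookup_minus lookup_single when_def)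
  have split: "\<alpha> = Poly_Mapping.single i r \<Longrightarrow> \<alpha> + \<beta> = \<gamma> \<Longrightarrow> i \<in> ?I \<and> \<beta> = \<gamma> - Poly_Mapping.single i r"
    for \<alpha> \<beta> i by (auto simp: lookup_add)
  have "inj_on ?g ?I"
    using assms by (intro inj_onI) (metis (no_types, lifting) Pair_inject keys_single less_irrefl singleton_inject)
  then have "(\<Sum>i\<in>?I. mps_coeff f (\<gamma> - Poly_Mapping.single i r)) =
      (\<Sum>(\<alpha>, \<beta>) \<in> ?g ` ?I. mps_coeff (psum r) \<alpha> * mps_coeff f \<beta>)"
    by (subst sum.reindex) (auto simp: psum_single)
  also have "\<dots> = mps_coeff (psum r * f) \<gamma>"
    unfolding mps_coeff_mult
  proof (rule sum.mono_neutral_left)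
    show "?g ` ?I \<subseteq> expvec_splits \<gamma>"
      using sub by (auto simp: expvec_splits_def)
    show "\<forall>p\<in>expvec_splits \<gamma> - ?g ` ?I. (case p of (\<alpha>, \<beta>) \<Rightarrow> mps_coeff (psum r) \<alpha> * mps_coeff f \<beta>) = 0"
    proof (rule ballI, clarify)
      fix \<alpha> \<beta> assume *: "(\<alpha>, \<beta>) \<in> expvec_splits \<gamma>" "(\<alpha>, \<beta>) \<notin> ?g ` ?I"
      then have "\<not> (\<exists>i. \<alpha> = Poly_Mapping.single i r)"
        using split by (auto simp: expvec_splits_def image_iff)
      then show "mps_coeff (psum r) \<alpha> * mps_coeff f \<beta> = 0"
        by (simp add: psum_def)
    qed
  qed simp
  finally show ?thesis by simp
qed

lemma finite_lookup_ge: "0 < r \<Longrightarrow> finite {i. r \<le> Poly_Mapping.lookup (\<gamma> :: expvec) i}"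
  by (rule finite_subset [of _ "Poly_Mapping.keys \<gamma>"]) (auto simp: in_keys_iff)

text \<open>Nonnegativity excludes cancellation, so one positive summand suffices for a nonzero
  leading coefficient. The ordering used here is available on \<open>ratfun\<close> too.\<close>

lemma psum_mset_coeff_nonneg:
  fixes M :: "nat multiset"
  assumes "0 \<notin># M"
  shows "0 \<le> mps_coeff (psum_mset M :: 'a::linordered_idom mps) \<alpha>"
  using assms
proof (induction M arbitrary: \<alpha>)
  case (add r M)
  then show ?case
    by (auto simp: mps_coeff_psum_mult intro!: sum_nonneg)
qed auto

text \<open>Expanding the product puts every part on some variable. If these variables are all
  different, the exponents are exactly \<open>M\<close>; any coincidence leaves fewer variables than
  parts.\<close>

lemma psum_mset_coeff_nonzero:
  assumes "0 \<notin># M" and "mps_coeff (psum_mset M :: 'a::comm_ring_1 mps) \<alpha> \<noteq> 0"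
  shows "card (Poly_Mapping.keys \<alpha>) < size M \<or> expvec_parts \<alpha> = M"
  using assms
proof (induction M arbitrary: \<alpha>)
  case empty
  then show ?case by (simp add: expvec_parts_def split: if_splits)
next
  case (add r M)
  then have r: "0 < r" by auto
  with add.prems obtain i where i: "r \<le> Poly_Mapping.lookup \<alpha> i"
    "mps_coeff (psum_mset M :: 'a mps) (\<alpha> - Poly_Mapping.single i r) \<noteq> 0"
    by (auto simp: mps_coeff_psum_mult elim!: sum.not_neutral_contains_not_neutral)
  define \<beta> where "\<beta> = \<alpha> - Poly_Mapping.single i r"
  have \<alpha>: "\<alpha> = Poly_Mapping.single i r + \<beta>"
    unfolding \<beta>_def using i
    by (intro poly_mapping_eqI) (auto simp: lookup_add lookup_minus lookup_single when_def)
  have IH: "card (Poly_Mapping.keys \<beta>) < size M \<or> expvec_parts \<beta> = M"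
    using add i by (simp add: \<beta>_def)
  then have le: "card (Poly_Mapping.keys \<beta>) \<le> size M"
    by (auto simp flip: size_expvec_parts)
  show ?case
  proof (cases "i \<in> Poly_Mapping.keys \<beta>")
    case True
    then show ?thesis
      using le r by (simp add: \<alpha> keys_single_add insert_absorb)
  next
    case False
    then show ?thesis
      using IH r by (auto simp: \<alpha> keys_single_add expvec_parts_single_add)
  qed
qed

lemma ex_psum_mset_leading:
  assumes "0 \<notin># M"
  shows "\<exists>\<alpha>. expvec_parts \<alpha> = M \<and> mps_coeff (psum_mset M :: 'a::linordered_idom mps) \<alpha> > 0"
  using assms
proof (induction M)
  case empty
  show ?case by (rule exI [of _ 0]) (simp add: expvec_parts_def)
next
  case (add r M)
  then obtain \<beta> where \<beta>: "expvec_parts \<beta> = M" "mps_coeff (psum_mset M :: 'a mps) \<beta> > 0"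
    by auto
  have r: "0 < r" and M: "0 \<notin># M" using add.prems by auto
  \<comment> \<open>A fresh variable receives the new part, so that no two parts merge.\<close>
  obtain i where i: "i \<notin> Poly_Mapping.keys \<beta>"
    using ex_new_if_finite [OF infinite_UNIV_nat finite_keys] by blast
  let ?\<alpha> = "Poly_Mapping.single i r + \<beta>"
  have "i \<in> {j. r \<le> Poly_Mapping.lookup ?\<alpha> j}"
    by (simp add: lookup_add)
  moreover have "mps_coeff (psum_mset M :: 'a mps) (?\<alpha> - Poly_Mapping.single i r) > 0"
    using \<beta> by simp
  ultimately have "mps_coeff (psum_mset (add_mset r M) :: 'a mps) ?\<alpha> > 0"
    unfolding psum_mset_simps mps_coeff_psum_mult [OF r]
    by (intro sum_pos2 [of _ i] finite_lookup_ge r psum_mset_coeff_nonneg M) auto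
  then show ?case
    using expvec_parts_single_add [OF r i] \<beta> by blast
qed

text \<open>Among the products with nonzero coefficient take \<open>L\<close> with the most parts. A
  monomial with exponents \<open>L\<close> has \<open>size L\<close> variables, so by
  \<open>psum_mset_coeff_nonzero\<close> it occurs in no other of these products.\<close>

theorem psum_mset_independent:
  fixes c :: "nat multiset \<Rightarrow> 'a::linordered_field"
  assumes "finite S" and pos: "\<And>M. M \<in> S \<Longrightarrow> 0 \<notin># M"
    and zero: "(\<Sum>M\<in>S. mps_const (c M) * psum_mset M) = 0"
    and "M \<in> S"
  shows "c M = 0"
proof (rule ccontr)
  assume "c M \<noteq> 0"
  let ?T = "{M\<in>S. c M \<noteq> 0}"
  have "finite ?T" "M \<in> ?T" using assms \<open>c M \<noteq> 0\<close> by auto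
  then have "Max (size ` ?T) \<in> size ` ?T"
    by (intro Max_in) auto
  then obtain L where L: "L \<in> ?T" "size L = Max (size ` ?T)"
    by (metis (no_types, lifting) imageE)
  have L_max: "size N \<le> size L" if "N \<in> ?T" for N
    using that \<open>finite ?T\<close> by (simp add: L(2))
  obtain \<alpha> where \<alpha>: "expvec_parts \<alpha> = L" "mps_coeff (psum_mset L :: 'a mps) \<alpha> > 0"
    using ex_psum_mset_leading pos L by blast
  have "c N * mps_coeff (psum_mset N) \<alpha> = 0" if "N \<in> S - {L}" for N
  proof (rule ccontr)
    assume *: "c N * mps_coeff (psum_mset N) \<alpha> \<noteq> 0"
    then have "card (Poly_Mapping.keys \<alpha>) < size N \<or> expvec_parts \<alpha> = N"
      using that pos by (intro psum_mset_coeff_nonzero) auto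
    moreover have "size N \<le> size L" using L_max [of N] that * by auto
    moreover have "card (Poly_Mapping.keys \<alpha>) = size L"
      using \<alpha> by (simp flip: size_expvec_parts)
    ultimately show False using \<alpha> that by auto
  qed
  then have "(\<Sum>N\<in>S - {L}. c N * mps_coeff (psum_mset N) \<alpha>) = 0"
    by (intro sum.neutral ballI)
  then have "(\<Sum>N\<in>S. c N * mps_coeff (psum_mset N) \<alpha>) = c L * mps_coeff (psum_mset L) \<alpha>"
    using \<open>finite S\<close> L by (subst sum.remove [of _ L]) auto
  moreover have "(\<Sum>N\<in>S. c N * mps_coeff (psum_mset N) \<alpha>) = 0"
    using arg_cong [OF zero, of "\<lambda>f. mps_coeff f \<alpha>"] by simp
  ultimately show False using L \<alpha> by auto
qed

section \<open>The plethystic substitution\<close>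

definition psum_monom :: "(nat \<Rightarrow> ratfun mps) \<Rightarrow> expvec \<Rightarrow> ratfun mps" where
  "psum_monom u m = (\<Prod>i\<in>Poly_Mapping.keys m. u (Suc i) ^ Poly_Mapping.lookup m i)"

lemma psum_monom_superset:
  assumes "finite A" and "Poly_Mapping.keys m \<subseteq> A"
  shows "psum_monom u m = (\<Prod>i\<in>A. u (Suc i) ^ Poly_Mapping.lookup m i)"
  unfolding psum_monom_def using assms
  by (intro prod.mono_neutral_left) (auto simp: in_keys_iff)

lemma psum_monom_add: "psum_monom u (m + n) = psum_monom u m * psum_monom u n"
proof -
  let ?A = "Poly_Mapping.keys m \<union> Poly_Mapping.keys n"
  have "psum_monom u m = (\<Prod>i\<in>?A. u (Suc i) ^ Poly_Mapping.lookup m i)"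
    "psum_monom u n = (\<Prod>i\<in>?A. u (Suc i) ^ Poly_Mapping.lookup n i)"
    "psum_monom u (m + n) = (\<Prod>i\<in>?A. u (Suc i) ^ Poly_Mapping.lookup (m + n) i)"
    using keys_add [of m n] by (auto intro: psum_monom_superset)
  then show ?thesis
    by (simp add: lookup_add power_add prod.distrib)
qed

lemma psum_poly_altdef:
  "psum_poly u F = (\<Sum>m\<in>Poly_Mapping.keys F. mps_const (Poly_Mapping.lookup F m) * psum_monom u m)"
  by (simp add: psum_poly_def psum_monom_def)

lemma psum_poly_single [simp]: "psum_poly u (Poly_Mapping.single m c) = mps_const c * psum_monom u m"
  by (simp add: psum_poly_altdef)

lemma psum_poly_0 [simp]: "psum_poly u 0 = 0"
  by (simp add: psum_poly_altdef)

lemma psum_poly_add: "psum_poly u (F + G) = psum_poly u F + psum_poly u G"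
  unfolding psum_poly_altdef
  by (rule setsum_keys_plus_distrib) (simp_all add: mps_const_add algebra_simps)

lemma psum_poly_sum: "psum_poly u (sum F A) = (\<Sum>x\<in>A. psum_poly u (F x))"
  by (induction A rule: infinite_finite_induct) (simp_all add: psum_poly_add)

lemma poly_mapping_sum_single:
  "F = (\<Sum>m\<in>Poly_Mapping.keys F. Poly_Mapping.single m (Poly_Mapping.lookup F m))"
proof (rule poly_mapping_eqI)
  fix k
  show "Poly_Mapping.lookup F k =
      Poly_Mapping.lookup (\<Sum>m\<in>Poly_Mapping.keys F. Poly_Mapping.single m (Poly_Mapping.lookup F m)) k"
    by (auto simp: lookup_sum lookup_single when_def sum.delta' in_keys_iff)
qed

lemma psum_poly_mult: "psum_poly u (F * G) = psum_poly u F * psum_poly u G"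
proof -
  let ?F = "Poly_Mapping.lookup F" and ?G = "Poly_Mapping.lookup G"
  have "F * G = (\<Sum>m\<in>Poly_Mapping.keys F. Poly_Mapping.single m (?F m)) *
      (\<Sum>n\<in>Poly_Mapping.keys G. Poly_Mapping.single n (?G n))"
    by (simp flip: poly_mapping_sum_single)
  also have "\<dots> = (\<Sum>m\<in>Poly_Mapping.keys F. \<Sum>n\<in>Poly_Mapping.keys G.
      Poly_Mapping.single (m + n) (?F m * ?G n))"
    by (simp add: sum_product mult_single)
  finally show ?thesis
    by (simp add: psum_poly_sum psum_monom_add mps_const_mult)
       (simp add: psum_poly_altdef sum_product algebra_simps)
qed

lemma psum_poly_hom: "unital_ring_hom (psum_poly u)"
proof
  have "psum_poly u (Poly_Mapping.single 0 1) = 1"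
    unfolding psum_poly_single by (simp add: psum_monom_def)
  then show "psum_poly u 1 = 1" by simp
qed (simp_all add: psum_poly_add psum_poly_mult)

lemma psum_poly_const: "psum_poly u (Poly_Mapping.single 0 c) = mps_const c"
  by (simp add: psum_monom_def)

lemma psum_poly_var:
  assumes "0 < r"
  shows "psum_poly u (Poly_Mapping.single (Poly_Mapping.single (r - 1) 1) 1) = u r"
  using assms by (simp add: psum_monom_def)

text \<open>The variable with index \<open>i\<close> stands for the power sum of index
  \<open>i + 1\<close>, hence the \<open>Suc\<close>.\<close>

definition monom_parts :: "expvec \<Rightarrow> nat multiset" where
  "monom_parts m = (\<Sum>i\<in>Poly_Mapping.keys m. replicate_mset (Poly_Mapping.lookup m i) (Suc i))"

lemma count_monom_parts: "count (monom_parts m) (Suc i) = Poly_Mapping.lookup m i"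
proof -
  have "count (monom_parts m) (Suc i) =
      (\<Sum>j\<in>Poly_Mapping.keys m. if j = i then Poly_Mapping.lookup m j else 0)"
    unfolding monom_parts_def count_sum by (intro sum.cong) auto
  then show ?thesis by (simp add: in_keys_iff)
qed

lemma inj_monom_parts: "inj monom_parts"
  by (rule injI, rule poly_mapping_eqI) (metis count_monom_parts)

lemma monom_parts_pos: "0 \<notin># monom_parts m"
  by (auto simp: monom_parts_def set_mset_sum in_replicate_mset)

lemma psum_mset_sum: "psum_mset (sum f A) = (\<Prod>x\<in>A. psum_mset (f x))"
  by (induction A rule: infinite_finite_induct) simp_all

lemma psum_mset_replicate: "psum_mset (replicate_mset n r) = psum r ^ n"
  by (induction n) simp_all

lemma psum_monom_psum: "psum_monom psum m = psum_mset (monom_parts m)"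
  by (simp add: psum_monom_def monom_parts_def psum_mset_sum psum_mset_replicate)

text \<open>Algebraic independence of the power sums; it gives the uniqueness demanded by the
  definite description in \<open>pleth\<close>.\<close>

lemma psum_poly_psum_inject: "psum_poly psum F = psum_poly psum G \<longleftrightarrow> F = G"
proof
  assume eq: "psum_poly psum F = psum_poly psum G"
  define D where "D = F - G"
  have "psum_poly psum D = 0"
    unfolding D_def using eq unital_ring_hom.hom_diff [OF psum_poly_hom] by simp
  then have "(\<Sum>m\<in>Poly_Mapping.keys D. mps_const (Poly_Mapping.lookup D m) * psum_mset (monom_parts m)) = 0"
    by (simp add: psum_poly_altdef psum_monom_psum)
  moreover define c where "c M = Poly_Mapping.lookup D (inv monom_parts M)" for M
  ultimately have *: "(\<Sum>M\<in>monom_parts ` Poly_Mapping.keys D. mps_const (c M) * psum_mset M) = 0"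
    by (simp add: sum.reindex [OF inj_on_subset [OF inj_monom_parts]] inv_f_f [OF inj_monom_parts])
  have "Poly_Mapping.lookup D m = 0" for m
  proof (cases "m \<in> Poly_Mapping.keys D")
    case True
    then have "c (monom_parts m) = 0"
      by (intro psum_mset_independent [OF _ _ *]) (auto simp: monom_parts_pos)
    then show ?thesis
      using inj_monom_parts by (simp add: c_def)
  qed (simp add: in_keys_iff)
  then have "D = 0" by (intro poly_mapping_eqI) simp
  then show "F = G" by (simp add: D_def)
qed simp

text \<open>The graph of the substitution on the algebra generated by the power sums. It is closed
  under the ring operations, whereas \<open>pleth\<close> is unspecified outside this algebra and
  would need membership proofs at every step.\<close>

definition pleth_rel :: "ratfun mps \<Rightarrow> ratfun mps \<Rightarrow> bool" where
  "pleth_rel f g \<longleftrightarrow> (\<exists>F. f = psum_poly psum F \<and> g = psum_poly (\<lambda>r. mps_const (\<qq> ^ r - 1) * psum r) F)"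

lemma pleth_eqI: "pleth_rel f g \<Longrightarrow> pleth f = g"
  by (auto simp: pleth_rel_def pleth_def psum_poly_psum_inject)

lemma pleth_rel_add: "pleth_rel f g \<Longrightarrow> pleth_rel f' g' \<Longrightarrow> pleth_rel (f + f') (g + g')"
  unfolding pleth_rel_def by (elim exE conjE, rule exI) (simp flip: psum_poly_add)

lemma pleth_rel_mult: "pleth_rel f g \<Longrightarrow> pleth_rel f' g' \<Longrightarrow> pleth_rel (f * f') (g * g')"
  unfolding pleth_rel_def by (elim exE conjE, rule exI) (simp flip: psum_poly_mult)

lemma pleth_rel_const: "pleth_rel (mps_const c) (mps_const c)"
  unfolding pleth_rel_def by (rule exI [of _ "Poly_Mapping.single 0 c"]) (simp only: psum_poly_const)

lemma pleth_rel_psum: "0 < r \<Longrightarrow> pleth_rel (psum r) (mps_const (\<qq> ^ r - 1) * psum r)"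
  unfolding pleth_rel_def
  by (rule exI [of _ "Poly_Mapping.single (Poly_Mapping.single (r - 1) 1) 1"]) (simp only: psum_poly_var)

lemma pleth_rel_sum:
  assumes "\<And>x. x \<in> A \<Longrightarrow> pleth_rel (f x) (g x)"
  shows "pleth_rel (sum f A) (sum g A)"
  using assms
proof (induction A rule: infinite_finite_induct)
  case (insert x A)
  then show ?case by (simp add: pleth_rel_add)
qed (use pleth_rel_const [of 0] in simp_all)

section \<open>The functions \<open>q\<^sub>n\<close>\<close>

lemma fps_nth_qfun_factor:
  "fps_nth ((1 + fps_X) / (1 - fps_X) :: 'a::field fps) k = (if k = 0 then 1 else 2)"
proof -
  let ?f = "Abs_fps (\<lambda>k. if k = 0 then 1 else 2) :: 'a fps"
  have "1 + fps_X = ?f * (1 - fps_X)"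
    by (rule fps_ext) (simp add: algebra_simps)
  then have "(1 + fps_X) / (1 - fps_X) = ?f * (1 - fps_X) / (1 - fps_X)"
    by (rule arg_cong)
  also have "\<dots> = ?f"
    by (rule nonzero_mult_div_cancel_right) (auto simp: fps_eq_iff intro: exI [of _ 0])
  finally show ?thesis by simp
qed

lemma qfun_coeff:
  "mps_coeff (qfun n) \<alpha> = (if expvec_size \<alpha> = n then 2 ^ card (Poly_Mapping.keys \<alpha>) else 0)"
  unfolding qfun_def mps_coeff_Abs_mps fps_nth_qfun_factor
  by (simp add: in_keys_iff)

lemma expvec_size_eq_0_iff: "expvec_size \<alpha> = 0 \<longleftrightarrow> \<alpha> = 0"
  by (auto simp: expvec_size_def in_keys_iff intro!: poly_mapping_eqI)

lemma qfun_0 [simp]: "qfun 0 = 1"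
  by (rule mps_eqI) (simp add: qfun_coeff expvec_size_eq_0_iff)

lemma expvec_size_minus_single:
  assumes "r \<le> Poly_Mapping.lookup \<alpha> i"
  shows "r \<le> expvec_size \<alpha>" and "expvec_size (\<alpha> - Poly_Mapping.single i r) = expvec_size \<alpha> - r"
proof -
  let ?K = "insert i (Poly_Mapping.keys \<alpha>)"
  have *: "expvec_size \<beta> = Poly_Mapping.lookup \<beta> i + sum (Poly_Mapping.lookup \<beta>) (Poly_Mapping.keys \<alpha> - {i})"
    if "Poly_Mapping.keys \<beta> \<subseteq> ?K" for \<beta> :: expvec
  proof -
    have "expvec_size \<beta> = sum (Poly_Mapping.lookup \<beta>) ?K"
      unfolding expvec_size_def using that by (intro sum.mono_neutral_left) (auto simp: in_keys_iff)
    then show ?thesis by (simp add: sum.insert_remove)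
  qed
  have "expvec_size \<alpha> = Poly_Mapping.lookup \<alpha> i + sum (Poly_Mapping.lookup \<alpha>) (Poly_Mapping.keys \<alpha> - {i})"
    by (rule *) auto
  moreover have "expvec_size (\<alpha> - Poly_Mapping.single i r) =
      (Poly_Mapping.lookup \<alpha> i - r) + sum (Poly_Mapping.lookup \<alpha>) (Poly_Mapping.keys \<alpha> - {i})"
    by (subst *) (auto simp: in_keys_iff lookup_minus lookup_single when_def split: if_splits)
  ultimately show "r \<le> expvec_size \<alpha>" "expvec_size (\<alpha> - Poly_Mapping.single i r) = expvec_size \<alpha> - r"
    using assms by auto
qed

lemma card_keys_minus_single:
  assumes "0 < r" and "r \<le> Poly_Mapping.lookup (\<alpha> :: expvec) i"
  shows "card (Poly_Mapping.keys (\<alpha> - Poly_Mapping.single i r)) =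
    (if r = Poly_Mapping.lookup \<alpha> i then card (Poly_Mapping.keys \<alpha>) - 1 else card (Poly_Mapping.keys \<alpha>))"
proof -
  have "Poly_Mapping.keys (\<alpha> - Poly_Mapping.single i r) =
      (if r = Poly_Mapping.lookup \<alpha> i then Poly_Mapping.keys \<alpha> - {i} else Poly_Mapping.keys \<alpha>)"
    using assms by (auto simp: in_keys_iff lookup_minus lookup_single when_def split: if_splits)
  moreover have "i \<in> Poly_Mapping.keys \<alpha>"
    using assms by (simp add: in_keys_iff)
  ultimately show ?thesis by simp
qed

section \<open>Newton's recursion for the \<open>q\<^sub>n\<close>\<close>

lemma card_odd_le: "2 * card {r. odd r \<and> r \<le> a} = a + a mod 2"
proof (induction a)
  case 0
  have "{r. odd r \<and> r \<le> (0::nat)} = {}" by (auto dest: odd_pos)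
  then show ?case by simp
next
  case (Suc a)
  have "{r. odd r \<and> r \<le> Suc a} =
      (if even a then insert (Suc a) {r. odd r \<and> r \<le> a} else {r. odd r \<and> r \<le> a})"
    by (auto simp: le_Suc_eq)
  moreover have "finite {r. odd r \<and> r \<le> a}"
    by (rule finite_subset [of _ "{..a}"]) auto
  ultimately have "card {r. odd r \<and> r \<le> Suc a} =
      (if even a then Suc (card {r. odd r \<and> r \<le> a}) else card {r. odd r \<and> r \<le> a})"
    by simp
  moreover have "a mod 2 = (if even a then 0 else 1)" "Suc a mod 2 = (if even a then 1 else 0)"
    by presburger+
  ultimately show ?case
    using Suc by (simp split: if_splits)
qed

text \<open>The contribution of one variable with exponent \<open>a\<close> to Newton's recursion.
  Taking away all of \<open>a\<close> loses a variable and so a factor 2; this happens only for odd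
  \<open>a\<close>, and it corrects the rounding in the number of odd \<open>r\<close> up to
  \<open>a\<close>.\<close>

lemma sum_odd_two_power:
  assumes "0 < k"
  shows "(\<Sum>r | odd r \<and> r \<le> a. 2 * 2 ^ (if r = a then k - 1 else k)) = (of_nat a * 2 ^ k :: 'a::comm_ring_1)"
proof -
  have "(2::'a) * 2 ^ (k - 1) = 2 ^ k"
    using assms by (cases k) auto
  then have "(\<Sum>r | odd r \<and> r \<le> a. 2 * 2 ^ (if r = a then k - 1 else k)) =
      (\<Sum>r | odd r \<and> r \<le> a. 2 * 2 ^ k - (if r = a then 2 ^ k else 0 :: 'a))"
    by (intro sum.cong) auto
  also have "\<dots> = of_nat (2 * card {r. odd r \<and> r \<le> a}) * 2 ^ k - (if odd a then 2 ^ k else 0)"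
    by (simp add: sum_subtractf)
  also have "\<dots> = of_nat a * 2 ^ k"
    unfolding card_odd_le by (simp add: algebra_simps odd_iff_mod_2_eq_one)
  finally show ?thesis .
qed

text \<open>The coefficientwise form of \<open>z H'(z) = H(z) \<cdot> 2 (p\<^sub>1 z + p\<^sub>3 z^3 + \<dots>)\<close>.\<close>

lemma qfun_newton:
  "of_nat n * qfun n = (\<Sum>r | odd r \<and> r \<le> n. 2 * psum r * qfun (n - r))"
proof (rule mps_eqI)
  fix \<alpha> :: expvec
  let ?k = "card (Poly_Mapping.keys \<alpha>)" and ?a = "Poly_Mapping.lookup \<alpha>"
  let ?R = "{r. odd r \<and> r \<le> n}"
  have coeff_term: "mps_coeff (2 * psum r * qfun (n - r)) \<alpha> =
      (\<Sum>i | i \<in> Poly_Mapping.keys \<alpha> \<and> r \<le> ?a i.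
        if expvec_size \<alpha> = n then 2 * 2 ^ (if r = ?a i then ?k - 1 else ?k) else 0)"
    if "r \<in> ?R" for r
  proof -
    have r: "0 < r" using that by (auto simp: odd_pos)
    have "mps_coeff (2 * psum r * qfun (n - r)) \<alpha> = 2 * mps_coeff (psum r * qfun (n - r)) \<alpha>"
      using mps_coeff_const_mult [of 2 "psum r * qfun (n - r)" \<alpha>] by (simp add: mult.assoc)
    also have "\<dots> = (\<Sum>i | r \<le> ?a i. 2 * mps_coeff (qfun (n - r)) (\<alpha> - Poly_Mapping.single i r))"
      by (simp add: mps_coeff_psum_mult [OF r] sum_distrib_left)
    also have "{i. r \<le> ?a i} = {i. i \<in> Poly_Mapping.keys \<alpha> \<and> r \<le> ?a i}"
      using r by (auto simp: in_keys_iff)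
    also have "(\<Sum>i | i \<in> Poly_Mapping.keys \<alpha> \<and> r \<le> ?a i.
          2 * mps_coeff (qfun (n - r)) (\<alpha> - Poly_Mapping.single i r)) =
        (\<Sum>i | i \<in> Poly_Mapping.keys \<alpha> \<and> r \<le> ?a i.
          if expvec_size \<alpha> = n then 2 * 2 ^ (if r = ?a i then ?k - 1 else ?k) else 0)"
    proof (rule sum.cong [OF refl])
      fix i assume "i \<in> {i. i \<in> Poly_Mapping.keys \<alpha> \<and> r \<le> ?a i}"
      then have i: "r \<le> ?a i" by simp
      have "expvec_size \<alpha> - r = n - r \<longleftrightarrow> expvec_size \<alpha> = n"
        using expvec_size_minus_single(1) [OF i] that by auto
      then show "2 * mps_coeff (qfun (n - r)) (\<alpha> - Poly_Mapping.single i r) =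
          (if expvec_size \<alpha> = n then 2 * 2 ^ (if r = ?a i then ?k - 1 else ?k) else 0)"
        by (simp add: qfun_coeff expvec_size_minus_single [OF i] card_keys_minus_single [OF r i])
    qed
    finally show ?thesis .
  qed
  have "mps_coeff (\<Sum>r\<in>?R. 2 * psum r * qfun (n - r)) \<alpha> =
      (\<Sum>r\<in>?R. \<Sum>i | i \<in> Poly_Mapping.keys \<alpha> \<and> r \<le> ?a i.
        if expvec_size \<alpha> = n then 2 * 2 ^ (if r = ?a i then ?k - 1 else ?k) else 0)"
    unfolding mps_coeff_sum by (rule sum.cong [OF refl coeff_term])
  \<comment> \<open>With the sum over the variables outside, each variable contributes its own
    exponent, and the exponents add up to the degree \<open>n\<close>.\<close>
  also have "\<dots> = (\<Sum>i\<in>Poly_Mapping.keys \<alpha>. \<Sum>r | r \<in> ?R \<and> r \<le> ?a i.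
        if expvec_size \<alpha> = n then 2 * 2 ^ (if r = ?a i then ?k - 1 else ?k) else 0)"
    by (rule sum.swap_restrict) auto
  also have "\<dots> = of_nat n * mps_coeff (qfun n) \<alpha>"
  proof (cases "expvec_size \<alpha> = n")
    case True
    have "(\<Sum>r | r \<in> ?R \<and> r \<le> ?a i. 2 * 2 ^ (if r = ?a i then ?k - 1 else ?k)) =
        (of_nat (?a i) * 2 ^ ?k :: ratfun)" if i: "i \<in> Poly_Mapping.keys \<alpha>" for i
    proof -
      have "?a i \<le> n"
        using expvec_size_minus_single(1) [OF order.refl, of \<alpha> i] True by simp
      then have "{r. r \<in> ?R \<and> r \<le> ?a i} = {r. odd r \<and> r \<le> ?a i}" by auto
      moreover have "0 < ?k" using i by (auto simp: card_gt_0_iff)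
      ultimately show ?thesis by (simp only: sum_odd_two_power)
    qed
    then have "(\<Sum>i\<in>Poly_Mapping.keys \<alpha>. \<Sum>r | r \<in> ?R \<and> r \<le> ?a i.
        if expvec_size \<alpha> = n then 2 * 2 ^ (if r = ?a i then ?k - 1 else ?k) else 0) =
        (\<Sum>i\<in>Poly_Mapping.keys \<alpha>. of_nat (?a i) * 2 ^ ?k :: ratfun)"
      by (intro sum.cong [OF refl]) (simp only: True simp_thms if_True)
    also have "\<dots> = of_nat (expvec_size \<alpha>) * 2 ^ ?k"
      by (simp add: expvec_size_def sum_distrib_right)
    finally show ?thesis using True by (simp add: qfun_coeff)
  qed (simp add: qfun_coeff)
  finally show "mps_coeff (of_nat n * qfun n) \<alpha> = mps_coeff (\<Sum>r\<in>?R. 2 * psum r * qfun (n - r)) \<alpha>"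
    by (simp flip: mps_const_of_nat)
qed

section \<open>Power series in z: the operator z d/dz, the rescaling f(c z), and logarithmic
  derivatives\<close>

definition euler_op :: "'a::comm_ring_1 fps \<Rightarrow> 'a fps" where
  "euler_op f = Abs_fps (\<lambda>n. of_nat n * fps_nth f n)"

definition fps_scale :: "'a::comm_ring_1 \<Rightarrow> 'a fps \<Rightarrow> 'a fps" where
  "fps_scale c f = Abs_fps (\<lambda>n. c ^ n * fps_nth f n)"

lemma euler_op_mult: "euler_op (f * g) = euler_op f * g + f * euler_op g"
proof (rule fps_ext)
  fix n
  have "of_nat n * (\<Sum>i=0..n. f $ i * g $ (n - i)) =
      (\<Sum>i=0..n. of_nat i * (f $ i) * g $ (n - i) + f $ i * (of_nat (n - i) * g $ (n - i)))"
    unfolding sum_distrib_left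
  proof (rule sum.cong [OF refl])
    fix i assume "i \<in> {0..n}"
    then have "n = i + (n - i)" by simp
    then have "(of_nat n :: 'a) = of_nat i + of_nat (n - i)" by (metis of_nat_add)
    then show "of_nat n * (f $ i * g $ (n - i)) =
        of_nat i * (f $ i) * g $ (n - i) + f $ i * (of_nat (n - i) * g $ (n - i))"
      by (simp add: algebra_simps)
  qed
  then show "euler_op (f * g) $ n = (euler_op f * g + f * euler_op g) $ n"
    by (simp add: euler_op_def fps_mult_nth sum.distrib)
qed

lemma fps_scale_mult: "fps_scale c (f * g) = fps_scale c f * fps_scale c g"
proof (rule fps_ext)
  fix n
  have "c ^ n * (\<Sum>i=0..n. f $ i * g $ (n - i)) =
      (\<Sum>i=0..n. c ^ i * f $ i * (c ^ (n - i) * g $ (n - i)))"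
    unfolding sum_distrib_left
  proof (rule sum.cong [OF refl])
    fix i assume "i \<in> {0..n}"
    then have "c ^ n = c ^ i * c ^ (n - i)" by (simp flip: power_add)
    then show "c ^ n * (f $ i * g $ (n - i)) = c ^ i * f $ i * (c ^ (n - i) * g $ (n - i))"
      by (simp add: algebra_simps)
  qed
  then show "fps_scale c (f * g) $ n = (fps_scale c f * fps_scale c g) $ n"
    by (simp add: fps_scale_def fps_mult_nth)
qed

lemma euler_op_scale: "euler_op (fps_scale c f) = fps_scale c (euler_op f)"
  by (rule fps_ext) (simp add: euler_op_def fps_scale_def algebra_simps)

definition qfun_fps :: "ratfun mps fps" where
  "qfun_fps = Abs_fps qfun"

definition psum_odd_fps :: "ratfun mps fps" where
  "psum_odd_fps = Abs_fps (\<lambda>r. if odd r then 2 * psum r else 0)"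

lemma euler_op_qfun: "euler_op qfun_fps = psum_odd_fps * qfun_fps"
proof (rule fps_ext)
  fix n
  have "(\<Sum>r | odd r \<and> r \<le> n. 2 * psum r * qfun (n - r)) =
      (\<Sum>r=0..n. (if odd r then 2 * psum r else 0) * qfun (n - r))"
    by (rule sum.mono_neutral_cong_left) auto
  then show "euler_op qfun_fps $ n = (psum_odd_fps * qfun_fps) $ n"
    by (simp add: euler_op_def qfun_fps_def psum_odd_fps_def fps_mult_nth qfun_newton)
qed

lemma fps_scale_minus_one_psum_odd: "fps_scale (-1) psum_odd_fps = - psum_odd_fps"
  by (rule fps_ext) (simp add: fps_scale_def psum_odd_fps_def)

text \<open>Logarithmic derivatives add up, and that of H(-z) is P(-z) = -P(z) because P has odd
  powers only. The case c = 1 makes H(z) H(-z) constant, the case c = \<qq> yields the recursion for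
  \<open>qdiff\<close>.\<close>

lemma euler_op_scaled_product:
  "euler_op (fps_scale c qfun_fps * fps_scale (-1) qfun_fps) =
    (fps_scale c psum_odd_fps - psum_odd_fps) * (fps_scale c qfun_fps * fps_scale (-1) qfun_fps)"
  by (simp add: euler_op_mult euler_op_scale euler_op_qfun fps_scale_mult
      fps_scale_minus_one_psum_odd algebra_simps)

lemma of_nat_mps_cancel:
  fixes f g :: "ratfun mps"
  assumes "of_nat n * f = of_nat n * g" and "0 < n"
  shows "f = g"
  by (rule mps_const_cancel [of "of_nat n"]) (use assms in \<open>simp_all add: mps_const_of_nat\<close>)

text \<open>The coefficient of \<open>z^n\<close> in \<open>H(\<qq> z) H(-z)\<close>, that is \<open>q\<^sub>n[(\<qq> - 1)X]\<close>.\<close>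

definition qdiff :: "nat \<Rightarrow> ratfun mps" where
  "qdiff n = (\<Sum>i\<le>n. mps_const (\<qq> ^ i * (-1) ^ (n - i)) * (qfun i * qfun (n - i)))"

lemma qfun_relation:
  assumes "0 < n"
  shows "(\<Sum>i\<le>n. (-1) ^ (n - i) * (qfun i * qfun (n - i))) = 0"
proof -
  have scale1: "fps_scale 1 f = f" for f :: "ratfun mps fps"
    by (rule fps_ext) (simp add: fps_scale_def)
  have "euler_op (qfun_fps * fps_scale (-1) qfun_fps) $ n = 0"
    using euler_op_scaled_product [of 1] by (simp add: scale1)
  then have "of_nat n * (\<Sum>i\<le>n. (-1) ^ (n - i) * (qfun i * qfun (n - i))) = of_nat n * 0"
    by (simp add: euler_op_def qfun_fps_def fps_scale_def fps_mult_nth algebra_simps atLeast0AtMost)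
  then show ?thesis
    using assms by (rule of_nat_mps_cancel)
qed

text \<open>For odd \<open>r\<close> the coefficient of z^r in P(\<qq> z) - P(z) is twice the image
  of \<open>psum r\<close> under the substitution, so this is \<open>qfun_newton\<close> after
  substituting.\<close>

lemma qdiff_newton:
  "of_nat n * qdiff n =
    (\<Sum>r | odd r \<and> r \<le> n. 2 * (mps_const (\<qq> ^ r - 1) * psum r) * qdiff (n - r))"
proof -
  define F where "F = fps_scale (mps_const \<qq>) qfun_fps * fps_scale (-1) qfun_fps"
  have F: "F $ n = qdiff n" for n
    by (simp add: F_def fps_mult_nth fps_scale_def qfun_fps_def qdiff_def mps_const_mult
        mps_const_power mps_const_minus algebra_simps atLeast0AtMost)
  have "of_nat n * qdiff n = euler_op F $ n"
    by (simp add: euler_op_def F)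
  also have "\<dots> = ((fps_scale (mps_const \<qq>) psum_odd_fps - psum_odd_fps) * F) $ n"
    unfolding F_def euler_op_scaled_product ..
  also have "\<dots> = (\<Sum>r=0..n. (if odd r then 2 * (mps_const (\<qq> ^ r - 1) * psum r) else 0) * qdiff (n - r))"
    unfolding fps_mult_nth F
    by (intro sum.cong) (auto simp: fps_scale_def psum_odd_fps_def mps_const_diff mps_const_power algebra_simps)
  also have "\<dots> = (\<Sum>r | odd r \<and> r \<le> n. 2 * (mps_const (\<qq> ^ r - 1) * psum r) * qdiff (n - r))"
    by (rule sum.mono_neutral_cong_right) auto
  finally show ?thesis .
qed

lemma qdiff_0 [simp]: "qdiff 0 = 1"
  by (simp add: qdiff_def)

text \<open>The two Newton recursions have the same shape, so induction transports one into the
  other. The case \<open>n = 0\<close> stands apart because the recursion is divided by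
  \<open>n\<close>.\<close>

lemma pleth_rel_qfun: "pleth_rel (qfun n) (qdiff n)"
proof (induction n rule: less_induct)
  case (less n)
  show ?case
  proof (cases "n = 0")
    case True
    then show ?thesis using pleth_rel_const [of 1] by simp
  next
    case False
    let ?c = "mps_const (1 / of_nat n) :: ratfun mps"
    let ?A = "\<Sum>r | odd r \<and> r \<le> n. 2 * psum r * qfun (n - r)"
    let ?B = "\<Sum>r | odd r \<and> r \<le> n. 2 * (mps_const (\<qq> ^ r - 1) * psum r) * qdiff (n - r)"
    have c: "?c * of_nat n = 1"
      using False by (simp flip: mps_const_of_nat mps_const_mult)
    have "pleth_rel (?c * ?A) (?c * ?B)"
    proof (intro pleth_rel_mult pleth_rel_sum pleth_rel_const)
      fix r assume "r \<in> {r. odd r \<and> r \<le> n}"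
      then have r: "0 < r" "r \<le> n" by (auto simp: odd_pos)
      show "pleth_rel 2 2" using pleth_rel_const [of 2] by simp
      show "pleth_rel (psum r) (mps_const (\<qq> ^ r - 1) * psum r)"
        by (rule pleth_rel_psum) (fact r)
      show "pleth_rel (qfun (n - r)) (qdiff (n - r))"
        using r by (intro less) auto
    qed
    moreover have "?c * ?A = qfun n" "?c * ?B = qdiff n"
      unfolding qfun_newton [symmetric] qdiff_newton [symmetric]
      by (simp_all flip: mult.assoc add: c)
    ultimately show ?thesis by simp
  qed
qed

lemma pleth_qfun_tilde: "pleth (qfun_tilde n) = mps_const (1 / (\<qq> - 1)) * qdiff n"
  unfolding qfun_tilde_def
  by (intro pleth_eqI pleth_rel_mult pleth_rel_const pleth_rel_qfun)

lemma invert_q_mps_qfun: "mps_map invert_q (qfun n) = qfun n"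
  by (rule mps_eqI)
     (simp add: mps_map_def qfun_coeff invert_q.hom_power invert_q.hom_numeral invert_q.hom_0)

text \<open>\<open>Q\<^sub>\<nu>\<close> is an integral polynomial in the \<open>q\<^sub>n\<close>,
  and the coefficients of these are 0 or powers of 2; none involves \<qq>.\<close>

lemma invert_q_mps_Qfun: "mps_map invert_q (Qfun \<nu>) = Qfun \<nu>"
proof -
  have "mps_map invert_q (Qfun2 r s) = Qfun2 r s" for r s
    by (simp add: Qfun2_def invert_q_mps.hom_add invert_q_mps.hom_mult invert_q_mps.hom_sum
        invert_q_mps.hom_numeral invert_q_mps.hom_minus_one_power invert_q_mps_qfun)
  then show ?thesis
    by (simp add: Qfun_def invert_q_mps.hom_pfaffian)
qed

lemma invert_q_mps_qdiff:
  "mps_map invert_q (qdiff n) = mps_const ((-1) ^ n * inverse \<qq> ^ n) * qdiff n"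
proof -
  have "mps_map invert_q (qdiff n) =
      (\<Sum>i\<le>n. mps_const (inverse \<qq> ^ i * (-1) ^ (n - i)) * (qfun i * qfun (n - i)))"
    by (simp add: qdiff_def invert_q_mps.hom_sum invert_q_mps.hom_mult invert_q.mps_map_const
        invert_q.hom_mult invert_q.hom_power invert_q.hom_minus invert_q.hom_1 invert_q_mps_qfun)
  also have "\<dots> = (\<Sum>i\<le>n. mps_const (inverse \<qq> ^ (n - i) * (-1) ^ i) * (qfun i * qfun (n - i)))"
    by (rule sum.reindex_bij_witness [where i = "\<lambda>i. n - i" and j = "\<lambda>i. n - i"])
       (auto simp: mult.commute)
  also have "\<dots> = mps_const ((-1) ^ n * inverse \<qq> ^ n) * qdiff n"
    unfolding qdiff_def sum_distrib_left
  proof (rule sum.cong [OF refl])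
    fix i assume "i \<in> {..n}"
    then have "n = i + (n - i)" by simp
    then obtain j where j: "n = i + j" by blast
    have "inverse \<qq> ^ (n - i) * (-1) ^ i =
        (-1) ^ n * inverse \<qq> ^ n * (\<qq> ^ i * (-1) ^ (n - i))"
      by (simp add: j power_add power_inverse field_simps flip: power_mult_distrib)
    then show "mps_const (inverse \<qq> ^ (n - i) * (-1) ^ i) * (qfun i * qfun (n - i)) =
        mps_const ((-1) ^ n * inverse \<qq> ^ n) *
        (mps_const (\<qq> ^ i * (-1) ^ (n - i)) * (qfun i * qfun (n - i)))"
      by (simp add: mps_const_mult flip: mult.assoc)
  qed
  finally show ?thesis .
qed

section \<open>The span of Schur's \<open>Q\<close>-functions\<close>

definition qfun_mset :: "nat multiset \<Rightarrow> ratfun mps" where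
  "qfun_mset M = (\<Prod>r\<in>#M. qfun r)"

lemma qfun_mset_simps [simp]:
  "qfun_mset {#} = 1"
  "qfun_mset (add_mset r M) = qfun r * qfun_mset M"
  "qfun_mset (M + N) = qfun_mset M * qfun_mset N"
  by (simp_all add: qfun_mset_def)

text \<open>The measure of spread that drives the straightening: passing from parts x \<ge> y to x +
  i, y - i with i > 0 keeps the sum and increases this number, which is bounded by the square of the
  sum.\<close>

definition sum_squares :: "nat multiset \<Rightarrow> nat" where
  "sum_squares M = (\<Sum>r\<in>#M. r\<^sup>2)"

lemma sum_squares_simps [simp]:
  "sum_squares {#} = 0"
  "sum_squares (add_mset r M) = r\<^sup>2 + sum_squares M"
  "sum_squares (M + N) = sum_squares M + sum_squares N"
  by (simp_all add: sum_squares_def)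

lemma sum_squares_le: "sum_squares M \<le> (\<Sum>\<^sub># M)\<^sup>2"
  by (induction M) (auto simp: power2_eq_square algebra_simps intro: add_mono trans_le_add2)

lemma sum_squares_spread:
  fixes x y i :: nat
  assumes "y \<le> x" and "0 < i" and "i \<le> y"
  shows "x\<^sup>2 + y\<^sup>2 < (x + i)\<^sup>2 + (y - i)\<^sup>2"
proof -
  obtain k where k: "y = i + k" using assms le_iff_add by blast
  then have "i * k < i * x" using assms by auto
  moreover have "(x + i)\<^sup>2 + k\<^sup>2 + 2 * (i * k) = x\<^sup>2 + (i + k)\<^sup>2 + 2 * (i * x)"
    by (simp add: power2_eq_square algebra_simps)
  ultimately have "x\<^sup>2 + (i + k)\<^sup>2 < (x + i)\<^sup>2 + k\<^sup>2" by linarith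
  then show ?thesis by (simp add: k)
qed

definition strict_partitions :: "nat \<Rightarrow> nat list set" where
  "strict_partitions n = {\<nu>. strict_partition \<nu> \<and> sum_list \<nu> = n}"

lemma length_le_sum_list: "0 \<notin> set xs \<Longrightarrow> length xs \<le> sum_list (xs :: nat list)"
  by (induction xs) auto

lemma finite_strict_partitions [simp, intro]: "finite (strict_partitions n)"
proof (rule finite_subset)
  show "strict_partitions n \<subseteq> {xs. set xs \<subseteq> {..n} \<and> length xs \<le> n}"
    by (auto simp: strict_partitions_def strict_partition_def length_le_sum_list
        intro: member_le_sum_list)
qed (rule finite_lists_length_le, simp)

lemma sum_minus_one_power: "(\<Sum>j<n. (-1) ^ j) = (if odd n then 1 else 0 :: 'a::ring_1)"
  by (induction n) auto

text \<open>The quadratic relation among the \<open>q\<^sub>n\<close> says that Schur's \<open>Q\<^bsub>(m,m)\<^esub>\<close> vanishes.\<close>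

lemma Qfun2_diag:
  assumes "0 < m"
  shows "Qfun2 m m = 0"
proof -
  let ?t = "\<lambda>i. (-1) ^ (2 * m - i) * (qfun i * qfun (2 * m - i))"
  \<comment> \<open>The relation in degree \<open>2 * m\<close> is split at its middle index; the
    two halves agree under the exchange of \<open>i\<close> and \<open>2 * m - i\<close>, which
    produces the factor 2 of \<open>Qfun2\<close>.\<close>
  have "{..2 * m} = insert m ({..<m} \<union> {m<..2 * m})" by auto
  then have all: "(\<Sum>i\<le>2 * m. ?t i) = ?t m + ((\<Sum>i<m. ?t i) + (\<Sum>i\<in>{m<..2 * m}. ?t i))"
    by (simp, subst sum.union_disjoint) auto
  have low: "(\<Sum>i<m. ?t i) = (\<Sum>i=1..m. (-1) ^ (m + i) * (qfun (m + i) * qfun (m - i)))"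
    by (intro sum.reindex_bij_witness [where i = "\<lambda>i. m - i" and j = "\<lambda>i. m - i"])
       (auto simp: mult_2 mult.commute [of "qfun _" "qfun _"])
  have high: "(\<Sum>i\<in>{m<..2 * m}. ?t i) = (\<Sum>i=1..m. (-1) ^ (m + i) * (qfun (m + i) * qfun (m - i)))"
    by (rule sum.reindex_bij_witness [where i = "\<lambda>i. m + i" and j = "\<lambda>i. i - m"])
       (auto simp: minus_one_power_iff mult_2)
  have zero: "(\<Sum>i\<le>2 * m. ?t i) = 0"
    using assms by (intro qfun_relation) simp
  have mid: "?t m = (-1) ^ m * (qfun m * qfun m)"
    by (simp add: mult_2)
  have "(-1) ^ m * (qfun m * qfun m) +
      2 * (\<Sum>i=1..m. (-1) ^ (m + i) * (qfun (m + i) * qfun (m - i))) = 0"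
    using all [symmetric] unfolding low high zero mid by (simp only: mult_2 [of "sum _ _"])
  moreover have "(\<Sum>i=1..m. (-1) ^ (m + i) * (qfun (m + i) * qfun (m - i))) =
      (-1) ^ m * (\<Sum>i=1..m. (-1) ^ i * (qfun (m + i) * qfun (m - i)))"
    by (simp add: sum_distrib_left power_add mult.assoc)
  ultimately have "(-1) ^ m * Qfun2 m m = 0"
    by (simp add: Qfun2_def algebra_simps)
  then have "(-1) ^ m * ((-1) ^ m * Qfun2 m m) = 0" by simp
  then show ?thesis
    by (simp flip: mult.assoc power_add add: mult_2 [symmetric])
qed

locale coeff_ring =
  fixes R :: "ratfun set"
  assumes R_1: "1 \<in> R" and R_q: "\<qq> \<in> R" and R_minus: "a \<in> R \<Longrightarrow> - a \<in> R"
    and R_add: "a \<in> R \<Longrightarrow> b \<in> R \<Longrightarrow> a + b \<in> R"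
    and R_mult: "a \<in> R \<Longrightarrow> b \<in> R \<Longrightarrow> a * b \<in> R"
begin

lemma R_0: "0 \<in> R"
  using R_add [OF R_1 R_minus [OF R_1]] by simp

lemma R_power: "a \<in> R \<Longrightarrow> a ^ n \<in> R"
  by (induction n) (auto intro: R_1 R_mult)

lemma R_sum: "(\<And>x. x \<in> A \<Longrightarrow> f x \<in> R) \<Longrightarrow> sum f A \<in> R"
  by (induction A rule: infinite_finite_induct) (auto intro: R_0 R_add)

lemma R_2: "2 \<in> R"
  using R_add [OF R_1 R_1] by simp

definition Qspan :: "nat \<Rightarrow> ratfun mps set" where
  "Qspan n = {\<Sum>\<nu>\<in>strict_partitions n. mps_const (c \<nu>) * Qfun \<nu> | c. \<forall>\<nu>. c \<nu> \<in> R}"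

lemma Qspan_add:
  assumes "f \<in> Qspan n" and "g \<in> Qspan n"
  shows "f + g \<in> Qspan n"
proof -
  obtain c d where "\<forall>\<nu>. c \<nu> \<in> R" "f = (\<Sum>\<nu>\<in>strict_partitions n. mps_const (c \<nu>) * Qfun \<nu>)"
    "\<forall>\<nu>. d \<nu> \<in> R" "g = (\<Sum>\<nu>\<in>strict_partitions n. mps_const (d \<nu>) * Qfun \<nu>)"
    using assms by (auto simp: Qspan_def)
  then show ?thesis unfolding Qspan_def
    by (intro CollectI exI [of _ "\<lambda>\<nu>. c \<nu> + d \<nu>"])
       (auto simp: R_add mps_const_add algebra_simps sum.distrib)
qed

lemma Qspan_scale:
  assumes "a \<in> R" and "f \<in> Qspan n"
  shows "mps_const a * f \<in> Qspan n"
proof -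
  obtain c where "\<forall>\<nu>. c \<nu> \<in> R" "f = (\<Sum>\<nu>\<in>strict_partitions n. mps_const (c \<nu>) * Qfun \<nu>)"
    using assms by (auto simp: Qspan_def)
  then show ?thesis unfolding Qspan_def using assms(1)
    by (intro CollectI exI [of _ "\<lambda>\<nu>. a * c \<nu>"])
       (auto simp: R_mult mps_const_mult mult.assoc sum_distrib_left)
qed

lemma Qspan_0: "0 \<in> Qspan n"
  unfolding Qspan_def using R_0 by (intro CollectI exI [of _ "\<lambda>_. 0"]) auto

lemma Qspan_diff: "f \<in> Qspan n \<Longrightarrow> g \<in> Qspan n \<Longrightarrow> f - g \<in> Qspan n"
  using Qspan_add [OF _ Qspan_scale [OF R_minus [OF R_1]], of f n g] by (simp add: mps_const_minus)

lemma Qspan_sum: "(\<And>x. x \<in> A \<Longrightarrow> f x \<in> Qspan n) \<Longrightarrow> sum f A \<in> Qspan n"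
  by (induction A rule: infinite_finite_induct) (auto intro: Qspan_0 Qspan_add)

lemma Qfun_in_Qspan:
  assumes "\<nu> \<in> strict_partitions n"
  shows "Qfun \<nu> \<in> Qspan n"
proof -
  have "Qfun \<nu> = (\<Sum>\<mu>\<in>strict_partitions n. mps_const (if \<mu> = \<nu> then 1 else 0) * Qfun \<mu>)"
    using assms by (simp add: if_distrib if_distribR sum.delta cong: if_cong)
  then show ?thesis unfolding Qspan_def using R_0 R_1
    by (intro CollectI exI [of _ "\<lambda>\<mu>. if \<mu> = \<nu> then 1 else 0"]) auto
qed

text \<open>In the Pfaffian every perfect matching contributes \<open>\<plusminus> q\<^sub>\<nu>\<close> plus products of \<open>q\<close>'s whose parts
  are more spread out, and the signs of all perfect matchings add up to 1.\<close>

lemma pfaffian_leading: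
  assumes "sorted_wrt (\<ge>) xs" and "even (length xs)" and "\<Sum>\<^sub># N + sum_list xs = n"
    and "\<And>M. \<Sum>\<^sub># M = n \<Longrightarrow> sum_squares N + sum_squares (mset xs) < sum_squares M \<Longrightarrow> qfun_mset M \<in> Qspan n"
  shows "qfun_mset N * pfaffian Qfun2 xs - qfun_mset (N + mset xs) \<in> Qspan n"
  using assms
proof (induction "length xs" arbitrary: xs N rule: less_induct)
  case less
  show ?case
  proof (cases xs)
    case Nil
    then show ?thesis by (simp add: Qspan_0)
  next
    case (Cons x ys)
    let ?q = "qfun_mset (N + mset xs)"
    let ?rest = "\<lambda>j. take j ys @ drop (Suc j) ys"
    \<comment> \<open>Apart from its sign, every term of the first-row expansion contributes one
      copy of \<open>?q\<close> modulo the span.\<close>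
    have pair: "qfun_mset N * (Qfun2 x (ys ! j) * pfaffian Qfun2 (?rest j)) - ?q \<in> Qspan n"
      if j: "j < length ys" for j
    proof -
      define y zs where "y = ys ! j" and "zs = ?rest j"
      have ys: "ys = take j ys @ y # drop (Suc j) ys"
        unfolding y_def using j by (rule id_take_nth_drop)
      have mset_ys: "mset ys = add_mset y (mset zs)"
        unfolding zs_def by (subst ys) simp
      have sum_ys: "sum_list ys = y + sum_list zs"
        using mset_ys by (metis sum_mset.add_mset sum_mset_sum_list)
      have "sorted_wrt (\<ge>) zs"
        using less.prems(1) unfolding Cons zs_def
        by (subst (asm) ys) (auto simp: sorted_wrt_append)
      moreover have "y \<le> x"
        using less.prems(1) j unfolding Cons y_def by simp
      moreover have "even (length zs)" "length zs < length xs"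
        using less.prems(2) j by (auto simp: Cons zs_def)
      moreover have squares: "sum_squares (mset xs) = x\<^sup>2 + y\<^sup>2 + sum_squares (mset zs)"
        by (simp add: Cons mset_ys)
      moreover have sums: "\<Sum>\<^sub># N + x + y + sum_list zs = n"
        using less.prems(3) by (simp add: Cons sum_ys)
      \<comment> \<open>The multiplier \<open>N\<close> absorbs the two parts produced by the entry
        of the first row, so the induction hypothesis applies to the smaller Pfaffian. The case i =
        0 belongs to the leading term of \<open>Qfun2 x y\<close>.\<close>
      ultimately have IH:
        "qfun_mset (N + {#x + i, y - i#}) * pfaffian Qfun2 zs - qfun_mset (N + {#x + i, y - i#} + mset zs) \<in> Qspan n"
        if "i \<le> y" for i
      proof -
        have "x\<^sup>2 + y\<^sup>2 \<le> (x + i)\<^sup>2 + (y - i)\<^sup>2"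
          using sum_squares_spread [OF \<open>y \<le> x\<close> _ that] by (cases "i = 0") auto
        then have "sum_squares N + sum_squares (mset xs) \<le>
            sum_squares (N + {#x + i, y - i#}) + sum_squares (mset zs)"
          by (simp add: squares)
        moreover have "\<Sum>\<^sub># (N + {#x + i, y - i#}) + sum_list zs = n"
          using sums that by simp
        ultimately show ?thesis
          using less.prems(4) \<open>sorted_wrt (\<ge>) zs\<close> \<open>even (length zs)\<close> \<open>length zs < length xs\<close>
          by (intro less.hyps) auto
      qed
      \<comment> \<open>For i > 0 the parts are strictly more spread out, so the leading product
        lies in the span by assumption, and with it the whole product.\<close>
      have spread: "qfun_mset (N + {#x + i, y - i#}) * pfaffian Qfun2 zs \<in> Qspan n"
        if "i \<in> {1..y}" for i
      proof -
        have "qfun_mset (N + {#x + i, y - i#} + mset zs) \<in> Qspan n"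
          using that sum_squares_spread [OF \<open>y \<le> x\<close>, of i] squares sums
          by (intro less.prems(4)) (auto simp: sum_mset_sum_list)
        then show ?thesis
          using Qspan_add [OF IH] that by fastforce
      qed
      have "qfun_mset N * (Qfun2 x y * pfaffian Qfun2 zs) - ?q =
          (qfun_mset (N + {#x + 0, y - 0#}) * pfaffian Qfun2 zs - qfun_mset (N + {#x + 0, y - 0#} + mset zs)) +
          (\<Sum>i=1..y. mps_const (2 * (-1) ^ i) * (qfun_mset (N + {#x + i, y - i#}) * pfaffian Qfun2 zs))"
        by (simp add: Cons mset_ys Qfun2_def sum_distrib_left sum_distrib_right mps_const_mult
            mps_const_power mps_const_minus algebra_simps)
      also have "\<dots> \<in> Qspan n"
        by (intro Qspan_add Qspan_sum Qspan_scale IH spread R_mult R_2 R_power R_minus R_1) simp_all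
      finally show ?thesis by (simp add: y_def zs_def)
    qed
    have "odd (length ys)" using less.prems(2) by (simp add: Cons)
    then have one: "(\<Sum>j<length ys. (-1) ^ j) = (1 :: ratfun mps)"
      by (simp add: sum_minus_one_power)
    let ?t = "\<lambda>j. qfun_mset N * (Qfun2 x (ys ! j) * pfaffian Qfun2 (?rest j))"
    have "qfun_mset N * pfaffian Qfun2 xs - ?q =
        (\<Sum>j<length ys. (-1) ^ j * ?t j) - (\<Sum>j<length ys. (-1) ^ j) * ?q"
      unfolding one by (simp add: Cons sum_distrib_left algebra_simps)
    also have "\<dots> = (\<Sum>j<length ys. mps_const ((-1) ^ j) * (?t j - ?q))"
      by (simp only: right_diff_distrib sum_subtractf sum_distrib_right mps_const_power mps_const_minus mps_const_1)
    also have "\<dots> \<in> Qspan n"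
      by (intro Qspan_sum Qspan_scale pair R_power R_minus R_1) auto
    finally show ?thesis .
  qed
qed

end

lemma sum_mset_filter_pos [simp]:
  "\<Sum>\<^sub># (filter_mset ((<) 0) M) = \<Sum>\<^sub># (M :: nat multiset)"
  "sum_squares (filter_mset ((<) 0) M) = sum_squares M"
  "qfun_mset (filter_mset ((<) 0) M) = qfun_mset M"
  by (induction M) auto

lemma ex_strict_partition_mset:
  assumes "0 \<notin># M" and "\<And>r. count M r \<le> 1"
  obtains \<nu> where "strict_partition \<nu>" and "mset \<nu> = M"
proof
  let ?xs = "sorted_list_of_multiset M"
  have "distinct ?xs"
    using assms(2) by (subst distinct_count_atmost_1) (auto simp: le_less_Suc_eq not_less_eq_eq le_Suc_eq count_eq_zero_iff)
  then have "sorted_wrt (<) ?xs"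
    by (simp add: strict_sorted_iff)
  then show "strict_partition (rev ?xs)"
    using assms(1) by (simp add: strict_partition_def sorted_wrt_rev)
qed simp

context coeff_ring
begin

text \<open>Downward induction on the spread. If the nonzero parts are distinct, the product is some
  \<open>Q\<^sub>\<nu>\<close> up to more spread products; a repeated part \<open>m\<close> is
  removed by the vanishing of \<open>Qfun2 m m\<close>, again in favour of more spread
  products.\<close>

theorem qfun_mset_in_Qspan:
  assumes "\<Sum>\<^sub># M = n"
  shows "qfun_mset M \<in> Qspan n"
  using assms
proof (induction "n\<^sup>2 - sum_squares M" arbitrary: M rule: less_induct)
  case less
  have larger: "qfun_mset K \<in> Qspan n" if "\<Sum>\<^sub># K = n" "sum_squares M < sum_squares K" for K
    using that sum_squares_le [of K] by (intro less.hyps) (auto intro: diff_less_mono2)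
  let ?M = "filter_mset ((<) 0) M"
  show ?case
  proof (cases "\<forall>r. count ?M r \<le> 1")
    case True
    moreover have "0 \<notin># ?M" by simp
    ultimately obtain \<nu> where \<nu>: "strict_partition \<nu>" "mset \<nu> = ?M"
      using ex_strict_partition_mset by metis
    have sum_\<nu>: "sum_list \<nu> = n"
      using less.prems \<nu>(2) by (metis sum_mset_filter_pos(1) sum_mset_sum_list)
    let ?xs = "if even (length \<nu>) then \<nu> else \<nu> @ [0]"
    have squares: "sum_squares (mset ?xs) = sum_squares M" and q: "qfun_mset (mset ?xs) = qfun_mset M"
      using \<nu>(2) by simp_all
    have "sorted_wrt (>) \<nu>"
      using \<nu>(1) by (simp add: strict_partition_def)
    then have "sorted_wrt (\<ge>) \<nu>"
      by (rule sorted_wrt_mono_rel [rotated]) auto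
    then have "sorted_wrt (\<ge>) ?xs"
      by (simp add: sorted_wrt_append)
    then have "qfun_mset {#} * pfaffian Qfun2 ?xs - qfun_mset ({#} + mset ?xs) \<in> Qspan n"
      by (rule pfaffian_leading) (use squares larger sum_\<nu> in auto)
    then have "Qfun \<nu> - qfun_mset M \<in> Qspan n"
      using q by (simp add: Qfun_def)
    moreover have "Qfun \<nu> \<in> Qspan n"
      using \<nu> sum_\<nu> by (intro Qfun_in_Qspan) (simp add: strict_partitions_def)
    ultimately show ?thesis
      using Qspan_diff [of "Qfun \<nu>" n "Qfun \<nu> - qfun_mset M"] by simp
  next
    case False
    then obtain m where m: "2 \<le> count ?M m"
      by (metis not_less_eq_eq numeral_2_eq_2 One_nat_def)
    then have "0 < m" "2 \<le> count M m"
      by (auto split: if_splits)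
    define K where "K = M - {#m, m#}"
    have K: "M = add_mset m (add_mset m K)"
      using \<open>2 \<le> count M m\<close> by (intro multiset_eqI) (auto simp: K_def)
    have "qfun m * qfun m = - (2 * (\<Sum>i=1..m. (-1) ^ i * (qfun (m + i) * qfun (m - i))))"
      using Qfun2_diag [OF \<open>0 < m\<close>] by (simp add: Qfun2_def eq_neg_iff_add_eq_0)
    then have "qfun_mset M = - (2 * (\<Sum>i=1..m. (-1) ^ i * (qfun (m + i) * qfun (m - i)))) * qfun_mset K"
      by (simp add: K flip: mult.assoc)
    also have "\<dots> = (\<Sum>i=1..m. mps_const (- (2 * (-1) ^ i)) * qfun_mset (add_mset (m + i) (add_mset (m - i) K)))"
      by (simp add: sum_distrib_left sum_distrib_right mps_const_mult mps_const_power
          mps_const_minus mult.assoc flip: sum_negf)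
    also have "\<dots> \<in> Qspan n"
    proof (intro Qspan_sum Qspan_scale larger)
      fix i assume i: "i \<in> {1..m}"
      show "- (2 * (-1) ^ i) \<in> R"
        by (intro R_mult R_2 R_power R_minus R_1)
      show "\<Sum>\<^sub># (add_mset (m + i) (add_mset (m - i) K)) = n"
        using less.prems i by (simp add: K)
      show "sum_squares M < sum_squares (add_mset (m + i) (add_mset (m - i) K))"
        using sum_squares_spread [of m m i] i by (simp add: K)
    qed
    finally show ?thesis .
  qed
qed

text \<open>Quantifying over a multiplier \<open>qfun_mset M\<close> makes closure under multiplication by \<open>q\<^sub>r\<close> immediate.\<close>

definition Gspan :: "nat \<Rightarrow> ratfun mps set" where
  "Gspan n = {f. \<forall>M. qfun_mset M * f \<in> Qspan (\<Sum>\<^sub># M + n)}"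

lemma Gspan_subset: "Gspan n \<subseteq> Qspan n"
  unfolding Gspan_def by (auto dest: spec [of _ "{#}"])

lemma Gspan_1: "1 \<in> Gspan 0"
  by (simp add: Gspan_def qfun_mset_in_Qspan)

lemma Gspan_scale: "a \<in> R \<Longrightarrow> f \<in> Gspan n \<Longrightarrow> mps_const a * f \<in> Gspan n"
  by (simp add: Gspan_def Qspan_scale mult.left_commute [of _ "mps_const a"])

lemma Gspan_sum: "(\<And>x. x \<in> A \<Longrightarrow> f x \<in> Gspan n) \<Longrightarrow> sum f A \<in> Gspan n"
  by (simp add: Gspan_def sum_distrib_left Qspan_sum)

lemma Gspan_diff: "f \<in> Gspan n \<Longrightarrow> g \<in> Gspan n \<Longrightarrow> f - g \<in> Gspan n"
  by (simp add: Gspan_def right_diff_distrib Qspan_diff)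

lemma Gspan_qfun_mult: "f \<in> Gspan n \<Longrightarrow> qfun r * f \<in> Gspan (r + n)"
  unfolding Gspan_def
proof (intro CollectI allI)
  fix M assume "f \<in> {f. \<forall>M. qfun_mset M * f \<in> Qspan (\<Sum>\<^sub># M + n)}"
  then have "qfun_mset (add_mset r M) * f \<in> Qspan (\<Sum>\<^sub># (add_mset r M) + n)" by blast
  then show "qfun_mset M * (qfun r * f) \<in> Qspan (\<Sum>\<^sub># M + (r + n))"
    by (simp add: algebra_simps)
qed

end

text \<open>Since \<open>qdiff n\<close> vanishes at \<open>\<qq> = 1\<close>, the factor \<open>\<qq> - 1\<close> can be divided out explicitly.\<close>

lemma pleth_qfun_tilde_expand:
  assumes "0 < n"
  shows "pleth (qfun_tilde n) =
    (\<Sum>i\<le>n. mps_const ((\<Sum>j<i. \<qq> ^ j) * (-1) ^ (n - i)) * (qfun i * qfun (n - i)))"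
proof -
  let ?d = "mps_const (1 / (\<qq> - 1))"
  \<comment> \<open>The subtracted sum is the value at \<qq> = 1 and vanishes by
    \<open>qfun_relation\<close>; it turns \<open>\<qq> ^ i\<close> into
    \<open>\<qq> ^ i - 1\<close>, a multiple of \<open>\<qq> - 1\<close>.\<close>
  have "qdiff n = qdiff n - (\<Sum>i\<le>n. (-1) ^ (n - i) * (qfun i * qfun (n - i)))"
    using assms by (simp add: qfun_relation)
  also have "\<dots> = (\<Sum>i\<le>n. mps_const ((\<qq> ^ i - 1) * (-1) ^ (n - i)) * (qfun i * qfun (n - i)))"
    by (simp add: qdiff_def mps_const_mult mps_const_diff mps_const_power mps_const_minus
        algebra_simps flip: sum_subtractf)
  finally have "?d * qdiff n =
      (\<Sum>i\<le>n. mps_const ((\<qq> ^ i - 1) / (\<qq> - 1) * (-1) ^ (n - i)) * (qfun i * qfun (n - i)))"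
    by (simp add: sum_distrib_left flip: mps_const_mult mult.assoc)
  moreover have "(\<qq> ^ i - 1) / (\<qq> - 1) = (\<Sum>j<i. \<qq> ^ j)" for i
    by (simp add: sum_gp_strict field_simps)
  ultimately show ?thesis
    by (simp only: pleth_qfun_tilde)
qed

context coeff_ring
begin

lemma Gspan_pleth_mult:
  assumes "0 < a" and "f \<in> Gspan n"
  shows "pleth (qfun_tilde a) * f \<in> Gspan (a + n)"
proof -
  have "pleth (qfun_tilde a) * f =
      (\<Sum>i\<le>a. mps_const ((\<Sum>j<i. \<qq> ^ j) * (-1) ^ (a - i)) * (qfun i * (qfun (a - i) * f)))"
    using assms by (simp add: pleth_qfun_tilde_expand sum_distrib_right mult.assoc)
  also have "\<dots> \<in> Gspan (a + n)"
  proof (intro Gspan_sum Gspan_scale)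
    fix i assume "i \<in> {..a}"
    then show "qfun i * (qfun (a - i) * f) \<in> Gspan (a + n)"
      using Gspan_qfun_mult [OF Gspan_qfun_mult [OF assms(2)], of i "a - i"]
      by (simp add: add.assoc [symmetric])
  qed (intro R_mult R_sum R_power R_q R_minus R_1)
  finally show ?thesis .
qed

lemma prod_pleth_in_Gspan:
  assumes "finite A" and "\<And>j. j \<in> A \<Longrightarrow> 0 < f j"
  shows "(\<Prod>j\<in>A. pleth (qfun_tilde (f j))) \<in> Gspan (sum f A)"
  using assms
proof (induction A rule: finite_induct)
  case empty
  show ?case by (simp add: Gspan_1)
next
  case (insert x A)
  then show ?case by (simp add: Gspan_pleth_mult)
qed

text \<open>Newton's recursion is solved for its last term \<open>2 * psum r\<close>, the remaining
  power sums being odd of smaller index. Halving is the only division involved.\<close>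

lemma Gspan_psum_mult:
  assumes half: "1 / 2 \<in> R" and "odd r" and "f \<in> Gspan n"
  shows "psum r * f \<in> Gspan (r + n)"
  using assms(2,3)
proof (induction r arbitrary: f n rule: less_induct)
  case (less r)
  let ?A = "{s. odd s \<and> s \<le> r}"
  have "?A = insert r {s. odd s \<and> s < r}"
    using \<open>odd r\<close> by auto
  moreover have "finite {s. odd s \<and> s < r}"
    by (rule finite_subset [of _ "{..<r}"]) auto
  ultimately have "of_nat r * qfun r = 2 * psum r + (\<Sum>s | odd s \<and> s < r. 2 * psum s * qfun (r - s))"
    by (simp add: qfun_newton)
  then have "2 * psum r = of_nat r * qfun r - (\<Sum>s | odd s \<and> s < r. 2 * psum s * qfun (r - s))"
    by simp
  then have "2 * psum r * f =
      of_nat r * (qfun r * f) - (\<Sum>s | odd s \<and> s < r. 2 * (psum s * (qfun (r - s) * f)))"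
    by (simp add: left_diff_distrib sum_distrib_right mult.assoc)
  also have "\<dots> \<in> Gspan (r + n)"
  proof (intro Gspan_diff Gspan_sum)
    have "of_nat r \<in> R" by (induction r) (auto intro: R_0 R_1 R_add)
    then show "of_nat r * (qfun r * f) \<in> Gspan (r + n)"
      unfolding mps_const_of_nat [symmetric]
      by (intro Gspan_scale Gspan_qfun_mult less.prems)
  next
    fix s assume "s \<in> {s. odd s \<and> s < r}"
    then have s: "odd s" "s < r" by auto
    have "psum s * (qfun (r - s) * f) \<in> Gspan (s + (r - s + n))"
      by (intro less.IH s Gspan_qfun_mult less.prems)
    then have "psum s * (qfun (r - s) * f) \<in> Gspan (r + n)"
      using s by (simp add: add.assoc [symmetric])
    then show "2 * (psum s * (qfun (r - s) * f)) \<in> Gspan (r + n)"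
      using Gspan_scale [OF R_2] by simp
  qed
  finally have "mps_const (1 / 2) * (2 * psum r * f) \<in> Gspan (r + n)"
    by (intro Gspan_scale half)
  moreover have "mps_const (1 / 2) * (2 * psum r * f) = psum r * f"
  proof -
    have "mps_const (1 / 2) * (2 :: ratfun mps) = 1"
      by (simp flip: mps_const_numeral mps_const_mult)
    then show ?thesis by (simp flip: mult.assoc)
  qed
  ultimately show ?case by simp
qed

lemma psum_mset_odd_in_Qspan:
  assumes "1 / 2 \<in> R" and "\<And>r. r \<in># M \<Longrightarrow> odd r"
  shows "psum_mset M \<in> Qspan (\<Sum>\<^sub># M)"
proof -
  have "psum_mset M \<in> Gspan (\<Sum>\<^sub># M)"
    using assms(2)
  proof (induction M)
    case empty
    show ?case by (simp add: Gspan_1)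
  next
    case (add r M)
    then show ?case by (simp add: Gspan_psum_mult assms(1))
  qed
  then show ?thesis using Gspan_subset by blast
qed

end

interpretation ratfun_ring: coeff_ring UNIV
  by unfold_locales auto

interpretation poly_ring: coeff_ring "range to_fract"
proof
  show "1 \<in> range (to_fract :: rat poly \<Rightarrow> ratfun)"
    by (metis rangeI to_fract_1)
  show "\<qq> \<in> range to_fract"
    by (simp add: \<qq>_def)
qed (auto simp flip: to_fract_add to_fract_mult to_fract_uminus)

section \<open>Linear independence of the \<open>Q\<close>-functions\<close>

text \<open>Glaisher's map: replace each part \<open>2^a m\<close> with \<open>m\<close> odd by \<open>2^a\<close> copies of \<open>m\<close>.\<close>

definition odd_part :: "nat \<Rightarrow> nat" where
  "odd_part x = x div 2 ^ multiplicity 2 x"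

definition glaisher :: "nat list \<Rightarrow> nat multiset" where
  "glaisher \<nu> = (\<Sum>x\<in>set \<nu>. replicate_mset (2 ^ multiplicity 2 x) (odd_part x))"

lemma two_power_mult_odd_part: "2 ^ multiplicity 2 x * odd_part x = x"
  by (simp add: odd_part_def multiplicity_dvd)

lemma odd_odd_part: "0 < x \<Longrightarrow> odd (odd_part x)"
  unfolding odd_part_def by (rule multiplicity_decompose) auto

text \<open>Parts with the same \<open>odd_part\<close> differ in their power of 2, so the binary
  digits of the multiplicity record which of them occur. Reading off the digits inverts Glaisher's
  map.\<close>

lemma count_glaisher:
  "count (glaisher \<nu>) m = set_encode (multiplicity 2 ` {x \<in> set \<nu>. odd_part x = m})"
proof -
  have "inj_on (multiplicity 2) {x \<in> set \<nu>. odd_part x = m}"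
    by (rule inj_onI) (metis (mono_tags, lifting) mem_Collect_eq two_power_mult_odd_part)
  then have "set_encode (multiplicity 2 ` {x \<in> set \<nu>. odd_part x = m}) =
      (\<Sum>x | x \<in> set \<nu> \<and> odd_part x = m. 2 ^ multiplicity 2 x)"
    by (simp add: set_encode_def sum.reindex)
  also have "\<dots> = (\<Sum>x\<in>set \<nu>. if odd_part x = m then 2 ^ multiplicity 2 x else 0)"
    by (rule sum.mono_neutral_cong_left) auto
  also have "\<dots> = count (glaisher \<nu>) m"
    unfolding glaisher_def count_sum by (rule sum.cong) auto
  finally show ?thesis by simp
qed

lemma mem_set_iff_glaisher:
  "x \<in> set \<nu> \<longleftrightarrow> multiplicity 2 x \<in> set_decode (count (glaisher \<nu>) (odd_part x))"
proof -
  have "multiplicity 2 x \<in> multiplicity 2 ` {y \<in> set \<nu>. odd_part y = odd_part x} \<longleftrightarrow> x \<in> set \<nu>"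
    by (auto simp: image_iff) (metis two_power_mult_odd_part)
  then show ?thesis
    by (simp add: count_glaisher)
qed

lemma strict_partition_eqI:
  assumes "strict_partition \<mu>" and "strict_partition \<nu>" and "set \<mu> = set \<nu>"
  shows "\<mu> = \<nu>"
proof -
  have "sorted_wrt (<) (rev \<mu>)" "sorted_wrt (<) (rev \<nu>)"
    using assms by (simp_all add: strict_partition_def sorted_wrt_rev)
  then have "rev \<mu> = rev \<nu>"
    using assms(3) by (intro strict_sorted_equal) auto
  then show ?thesis by simp
qed

lemma inj_on_glaisher: "inj_on glaisher (Collect strict_partition)"
proof (rule inj_onI)
  fix \<mu> \<nu> assume "\<mu> \<in> Collect strict_partition" "\<nu> \<in> Collect strict_partition"
    and "glaisher \<mu> = glaisher \<nu>"
  then show "\<mu> = \<nu>"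
    using mem_set_iff_glaisher [of _ \<mu>] mem_set_iff_glaisher [of _ \<nu>]
    by (intro strict_partition_eqI) auto
qed

lemma odd_glaisher:
  assumes "strict_partition \<nu>" and "r \<in># glaisher \<nu>"
  shows "odd r"
proof -
  obtain x where "x \<in> set \<nu>" "r = odd_part x"
    using assms(2) by (auto simp: glaisher_def set_mset_sum split: if_splits)
  moreover have "0 < x"
    using assms(1) \<open>x \<in> set \<nu>\<close> by (metis strict_partition_def gr0I)
  ultimately show ?thesis by (simp add: odd_odd_part)
qed

lemma sum_glaisher:
  assumes "strict_partition \<nu>"
  shows "\<Sum>\<^sub># (glaisher \<nu>) = sum_list \<nu>"
proof -
  have add: "\<Sum>\<^sub># (sum f A) = (\<Sum>x\<in>A. \<Sum>\<^sub># (f x))" for f :: "nat \<Rightarrow> nat multiset" and A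
    by (induction A rule: infinite_finite_induct) auto
  have "sorted_wrt (<) (rev \<nu>)"
    using assms by (simp add: strict_partition_def sorted_wrt_rev)
  then have "distinct \<nu>"
    by (simp add: strict_sorted_iff)
  then show ?thesis
    using sum_list_distinct_conv_sum_set [of \<nu> "\<lambda>x. x"]
    by (simp add: glaisher_def add two_power_mult_odd_part)
qed

interpretation mps_vs: vector_space "\<lambda>(c :: ratfun) f. mps_const c * f"
  by unfold_locales (simp_all add: algebra_simps mps_const_add mps_const_mult)

text \<open>An exchange argument: the functions \<open>p\<^sub>\<rho>\<close> for \<open>\<rho>\<close> in the image of Glaisher's map are
  independent, lie in the span of the \<open>Q\<^sub>\<nu>\<close>, and are equally many.\<close>

theorem Qfun_independent:
  assumes "finite S" and strict: "\<And>\<nu>. \<nu> \<in> S \<Longrightarrow> strict_partition \<nu>"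
    and zero: "(\<Sum>\<nu>\<in>S. mps_const (c \<nu>) * Qfun \<nu>) = 0"
    and "\<nu> \<in> S"
  shows "c \<nu> = 0"
proof -
  \<comment> \<open>\<open>S\<close> may mix partitions of different sizes. All strict partitions of
    size at most \<open>N\<close> form a finite set containing \<open>S\<close> and complete in
    every degree that occurs.\<close>
  define N where "N = Max (sum_list ` S)"
  define A where "A = (\<Union>n\<le>N. strict_partitions n)"
  define B where "B = glaisher ` A"
  have "finite A" by (simp add: A_def)
  have "S \<subseteq> A"
    using assms by (auto simp: A_def N_def strict_partitions_def)
  have "inj_on glaisher A"
    by (rule inj_on_subset [OF inj_on_glaisher]) (auto simp: A_def strict_partitions_def)
  then have card_B: "card B = card A" "finite B"
    using \<open>finite A\<close> by (simp_all add: B_def card_image)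
  have pos: "0 \<notin># M" if "M \<in> B" for M
    using that odd_glaisher by (fastforce simp: A_def B_def strict_partitions_def)
  have inj_psum: "inj_on (psum_mset :: _ \<Rightarrow> ratfun mps) B"
  proof (rule inj_onI, rule ccontr)
    fix M L assume eq: "M \<in> B" "L \<in> B" "psum_mset M = (psum_mset L :: ratfun mps)" "M \<noteq> L"
    then have "(\<Sum>K\<in>{M, L}. mps_const (if K = M then 1 else -1) * psum_mset K) = (0 :: ratfun mps)"
      by (simp add: mps_const_minus)
    from psum_mset_independent [OF _ _ this, of M] pos eq show False by auto
  qed
  then have card_psum: "card (psum_mset ` B :: ratfun mps set) = card A"
    using inj_psum by (simp add: card_image card_B)
  have indep: "mps_vs.independent (psum_mset ` B)"
    unfolding mps_vs.independent_explicit_finite_subsets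
  proof (intro allI impI ballI)
    fix T :: "ratfun mps set" and u v assume T: "T \<subseteq> psum_mset ` B" "finite T" "(\<Sum>v\<in>T. mps_const (u v) * v) = 0" "v \<in> T"
    then obtain C where C: "C \<subseteq> B" "T = psum_mset ` C"
      by (meson subset_image_iff)
    then have "inj_on (psum_mset :: _ \<Rightarrow> ratfun mps) C"
      using inj_psum inj_on_subset by blast
    then have "(\<Sum>M\<in>C. mps_const (u (psum_mset M)) * psum_mset M) = 0"
      using T(3) unfolding C(2) by (subst (asm) sum.reindex) simp_all
    moreover obtain M where "v = psum_mset M" "M \<in> C"
      using T C by auto
    moreover have "finite C"
      using C(1) card_B(2) finite_subset by blast
    ultimately show "u v = 0"
      using psum_mset_independent [of C "\<lambda>M. u (psum_mset M)"] C(1) pos by blast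
  qed
  have "f \<in> mps_vs.span (Qfun ` A)" if "f \<in> psum_mset ` B" for f
  proof -
    obtain \<mu> where \<mu>: "\<mu> \<in> A" "f = psum_mset (glaisher \<mu>)"
      using \<open>f \<in> psum_mset ` B\<close> by (auto simp: B_def)
    then obtain n where n: "n \<le> N" "strict_partition \<mu>" "sum_list \<mu> = n"
      by (auto simp: A_def strict_partitions_def)
    then have "f \<in> ratfun_ring.Qspan n"
      using ratfun_ring.psum_mset_odd_in_Qspan [of "glaisher \<mu>"] odd_glaisher sum_glaisher \<mu>
      by auto
    then obtain d where "f = (\<Sum>\<nu>\<in>strict_partitions n. mps_const (d \<nu>) * Qfun \<nu>)"
      by (auto simp: ratfun_ring.Qspan_def)
    moreover have "strict_partitions n \<subseteq> A"
      using n(1) by (auto simp: A_def)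
    then have "Qfun \<nu> \<in> mps_vs.span (Qfun ` A)" if "\<nu> \<in> strict_partitions n" for \<nu>
      using that by (intro mps_vs.span_base) auto
    ultimately show ?thesis
      by (simp add: mps_vs.span_sum mps_vs.span_scale)
  qed
  then have span: "psum_mset ` B \<subseteq> mps_vs.span (Qfun ` A)" by blast
  \<comment> \<open>The exchange lemma: a finite set whose span contains the power sum products has
    at least \<open>card A\<close> elements.\<close>
  have bound: "card A \<le> card X" if "finite X" "psum_mset ` B \<subseteq> mps_vs.span X" for X
    using mps_vs.independent_span_bound [OF that(1) indep that(2)] card_psum by simp
  have "card (Qfun ` A) = card A"
    using bound [OF _ span] card_image_le [of A Qfun] \<open>finite A\<close> by simp
  then have inj: "inj_on Qfun A"
    using \<open>finite A\<close> eq_card_imp_inj_on by blast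
  have "\<not> mps_vs.dependent (Qfun ` A)"
  proof
    assume "mps_vs.dependent (Qfun ` A)"
    then obtain a where a: "a \<in> Qfun ` A" "a \<in> mps_vs.span (Qfun ` A - {a})"
      unfolding mps_vs.dependent_def by blast
    then have "mps_vs.span (Qfun ` A) = mps_vs.span (Qfun ` A - {a})"
      using mps_vs.span_redundant [OF a(2)] by (simp add: insert_absorb)
    \<comment> \<open>Without the redundant element the set would still span, but with fewer than
      \<open>card A\<close> elements.\<close>
    then have "card A \<le> card (Qfun ` A - {a})"
      using span \<open>finite A\<close> by (intro bound) auto
    also have "\<dots> < card (Qfun ` A)"
      using a(1) \<open>finite A\<close> by (intro card_Diff1_less) auto
    finally show False
      using card_image_le [of A Qfun] \<open>finite A\<close> by simp
  qed
  then have indep_Qfun: "\<forall>T\<subseteq>Qfun ` A. finite T \<longrightarrow>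
      (\<forall>u. (\<Sum>f\<in>T. mps_const (u f) * f) = 0 \<longrightarrow> (\<forall>f\<in>T. u f = 0))"
    by (rule mps_vs.independent_explicit_finite_subsets [THEN iffD1])
  have inj_S: "inj_on Qfun S"
    using inj \<open>S \<subseteq> A\<close> inj_on_subset by blast
  \<comment> \<open>Independence concerns a set of functions; injectivity on \<open>S\<close> moves
    coefficients indexed by partitions over to it.\<close>
  then have "(\<Sum>f\<in>Qfun ` S. mps_const (c (inv_into S Qfun f)) * f) = 0"
    using zero by (simp add: sum.reindex)
  then have "\<forall>f\<in>Qfun ` S. c (inv_into S Qfun f) = 0"
    using \<open>S \<subseteq> A\<close> \<open>finite S\<close>
    by (intro ballI indep_Qfun [rule_format, of "Qfun ` S" "\<lambda>f. c (inv_into S Qfun f)"]) auto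
  then have "c (inv_into S Qfun (Qfun \<nu>)) = 0"
    using \<open>\<nu> \<in> S\<close> by blast
  then show ?thesis
    using inj_S \<open>\<nu> \<in> S\<close> by simp
qed

lemma Qfun_expansion_unique:
  assumes "finite S" and "\<And>\<nu>. \<nu> \<in> S \<Longrightarrow> strict_partition \<nu>"
    and "(\<Sum>\<nu>\<in>S. mps_const (c \<nu>) * Qfun \<nu>) = (\<Sum>\<nu>\<in>S. mps_const (d \<nu>) * Qfun \<nu>)"
    and "\<nu> \<in> S"
  shows "c \<nu> = d \<nu>"
proof -
  have "(\<Sum>\<nu>\<in>S. mps_const (c \<nu> - d \<nu>) * Qfun \<nu>) = 0"
    using assms(3) by (simp add: mps_const_diff left_diff_distrib sum_subtractf)
  then have "c \<nu> - d \<nu> = 0"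
    using assms by (intro Qfun_independent [where S = S and c = "\<lambda>\<nu>. c \<nu> - d \<nu>"]) auto
  then show ?thesis by simp
qed

section \<open>The symmetry of \<open>\<zeta>\<close>\<close>

abbreviation two_weight :: "nat list \<Rightarrow> ratfun" where
  "two_weight \<nu> \<equiv> 2 ^ ((length \<nu> + parity_len \<nu>) div 2)"

definition pleth_prod :: "expvec \<Rightarrow> ratfun mps" where
  "pleth_prod \<alpha> = (\<Prod>j\<in>Poly_Mapping.keys \<alpha>. pleth (qfun_tilde (Poly_Mapping.lookup \<alpha> j)))"

text \<open>Any valid expansion is the described one: two of them are compared on the union of their
  supports, where the \<open>Q\<^sub>\<nu>\<close> are independent.\<close>

lemma zeta_family_eqI:
  assumes strict: "\<forall>\<nu>\<in>Poly_Mapping.keys c. strict_partition \<nu>"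
    and expand: "pleth_prod \<alpha> = (\<Sum>\<nu>\<in>Poly_Mapping.keys c.
      mps_const (1 / two_weight \<nu> * Poly_Mapping.lookup c \<nu>) * Qfun \<nu>)"
  shows "zeta_family \<alpha> = c"
  unfolding zeta_family_def pleth_prod_def [symmetric]
proof (rule the_equality)
  fix d :: "nat list \<Rightarrow>\<^sub>0 ratfun"
  assume d: "(\<forall>\<nu>\<in>Poly_Mapping.keys d. strict_partition \<nu>) \<and> pleth_prod \<alpha> =
    (\<Sum>\<nu>\<in>Poly_Mapping.keys d. mps_const (1 / two_weight \<nu> * Poly_Mapping.lookup d \<nu>) * Qfun \<nu>)"
  let ?S = "Poly_Mapping.keys c \<union> Poly_Mapping.keys d"
  have extend: "(\<Sum>\<nu>\<in>Poly_Mapping.keys e. mps_const (1 / two_weight \<nu> * Poly_Mapping.lookup e \<nu>) * Qfun \<nu>) =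
      (\<Sum>\<nu>\<in>?S. mps_const (1 / two_weight \<nu> * Poly_Mapping.lookup e \<nu>) * Qfun \<nu>)"
    if "Poly_Mapping.keys e \<subseteq> ?S" for e
    using that by (intro sum.mono_neutral_left) (auto simp: in_keys_iff)
  have sums: "(\<Sum>\<nu>\<in>?S. mps_const (1 / two_weight \<nu> * Poly_Mapping.lookup d \<nu>) * Qfun \<nu>) =
      (\<Sum>\<nu>\<in>?S. mps_const (1 / two_weight \<nu> * Poly_Mapping.lookup c \<nu>) * Qfun \<nu>)"
    using conjunct2 [OF d] expand unfolding extend [OF Un_upper1] extend [OF Un_upper2] by (rule trans [OF sym])
  have eq: "1 / two_weight \<nu> * Poly_Mapping.lookup d \<nu> = 1 / two_weight \<nu> * Poly_Mapping.lookup c \<nu>"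
    if "\<nu> \<in> ?S" for \<nu>
    using d strict that by (intro Qfun_expansion_unique [OF _ _ sums]) auto
  show "d = c"
  proof (rule poly_mapping_eqI)
    fix \<nu>
    show "Poly_Mapping.lookup d \<nu> = Poly_Mapping.lookup c \<nu>"
      using eq [of \<nu>] by (cases "\<nu> \<in> ?S") (auto simp: in_keys_iff)
  qed
qed (use assms in blast)

text \<open>Straightening with polynomial coefficients provides an expansion, supported on strict
  partitions of the size of \<alpha>. By uniqueness it is the one defining \<open>zeta\<close>,
  which therefore inherits all three properties.\<close>

lemma zeta_expansion:
  "pleth_prod \<alpha> = (\<Sum>\<nu>\<in>strict_partitions (expvec_size \<alpha>). mps_const (1 / two_weight \<nu> * zeta \<nu> \<alpha>) * Qfun \<nu>)"
  and zeta_in_polys: "zeta \<nu> \<alpha> \<in> range to_fract"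
  and zeta_eq_0: "\<nu> \<notin> strict_partitions (expvec_size \<alpha>) \<Longrightarrow> zeta \<nu> \<alpha> = 0"
proof -
  let ?S = "strict_partitions (expvec_size \<alpha>)"
  have "pleth_prod \<alpha> \<in> poly_ring.Gspan (expvec_size \<alpha>)"
    unfolding pleth_prod_def expvec_size_def
    by (rule poly_ring.prod_pleth_in_Gspan) (auto simp: in_keys_iff)
  then have "pleth_prod \<alpha> \<in> poly_ring.Qspan (expvec_size \<alpha>)"
    using poly_ring.Gspan_subset by blast
  then obtain d where d: "\<And>\<nu>. d \<nu> \<in> range to_fract"
    "pleth_prod \<alpha> = (\<Sum>\<nu>\<in>?S. mps_const (d \<nu>) * Qfun \<nu>)"
    by (auto simp: poly_ring.Qspan_def)
  \<comment> \<open>The factor \<open>two_weight\<close> undoes the normalisation in the definition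
    of \<zeta>; being a power of 2, it preserves polynomials.\<close>
  define c where "c = Abs_poly_mapping (\<lambda>\<nu>. if \<nu> \<in> ?S then two_weight \<nu> * d \<nu> else 0)"
  have c: "Poly_Mapping.lookup c \<nu> = (if \<nu> \<in> ?S then two_weight \<nu> * d \<nu> else 0)" for \<nu>
    unfolding c_def
    by (subst lookup_Abs_poly_mapping) (auto intro: finite_subset [OF _ finite_strict_partitions])
  have keys_c: "Poly_Mapping.keys c \<subseteq> ?S"
    by (auto simp: in_keys_iff c split: if_splits)
  have expand: "pleth_prod \<alpha> = (\<Sum>\<nu>\<in>?S. mps_const (1 / two_weight \<nu> * Poly_Mapping.lookup c \<nu>) * Qfun \<nu>)"
    unfolding d(2) by (intro sum.cong) (simp_all add: c)
  also have "\<dots> = (\<Sum>\<nu>\<in>Poly_Mapping.keys c. mps_const (1 / two_weight \<nu> * Poly_Mapping.lookup c \<nu>) * Qfun \<nu>)"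
    using keys_c by (intro sum.mono_neutral_right) (auto simp: in_keys_iff)
  finally have "zeta_family \<alpha> = c"
    using keys_c by (intro zeta_family_eqI) (auto simp: strict_partitions_def)
  then have zeta: "zeta \<nu> \<alpha> = Poly_Mapping.lookup c \<nu>" for \<nu>
    by (simp add: zeta_def)
  show "pleth_prod \<alpha> = (\<Sum>\<nu>\<in>?S. mps_const (1 / two_weight \<nu> * zeta \<nu> \<alpha>) * Qfun \<nu>)"
    unfolding zeta by (fact expand)
  show "zeta \<nu> \<alpha> \<in> range to_fract"
    unfolding zeta c
    by (auto intro!: poly_ring.R_mult poly_ring.R_power poly_ring.R_2 poly_ring.R_0 d)
  show "zeta \<nu> \<alpha> = 0" if "\<nu> \<notin> ?S"
    using that by (simp add: zeta c)
qed

lemma invert_q_mps_qdiff_prod: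
  "mps_map invert_q (\<Prod>j\<in>A. qdiff (f j)) =
    mps_const ((-1) ^ sum f A * inverse \<qq> ^ sum f A) * (\<Prod>j\<in>A. qdiff (f j))"
  by (simp add: invert_q_mps.hom_prod invert_q_mps_qdiff prod.distrib power_sum mps_const_mult mps_const_prod)

text \<open>The power of \<open>\<qq> - 1\<close> turns \<open>pleth_prod\<close> into a product of
  \<open>qdiff\<close>, on which inversion acts by a scalar. Since the \<open>Q\<^sub>\<mu>\<close>
  are fixed and independent, each coefficient acquires the same scalar.\<close>

lemma invert_q_Gc_coeff:
  assumes "strict_partition \<nu>" and "sum_list \<nu> = n"
  shows "invert_q ((\<qq> - 1) ^ expvec_len \<alpha> * zeta \<nu> \<alpha>) =
    (-1) ^ n * inverse \<qq> ^ n * ((\<qq> - 1) ^ expvec_len \<alpha> * zeta \<nu> \<alpha>)"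
proof (cases "expvec_size \<alpha> = n")
  case False
  then have "zeta \<nu> \<alpha> = 0"
    using assms by (intro zeta_eq_0) (simp add: strict_partitions_def)
  then show ?thesis by (simp add: invert_q.hom_0)
next
  case True
  let ?S = "strict_partitions n" and ?\<kappa> = "(-1) ^ n * inverse \<qq> ^ n"
  define e where "e \<mu> = (\<qq> - 1) ^ expvec_len \<alpha> * (1 / two_weight \<mu> * zeta \<mu> \<alpha>)" for \<mu>
  define D where "D = (\<Prod>j\<in>Poly_Mapping.keys \<alpha>. qdiff (Poly_Mapping.lookup \<alpha> j))"
  have "D = (\<Prod>j\<in>Poly_Mapping.keys \<alpha>. mps_const (\<qq> - 1) * pleth (qfun_tilde (Poly_Mapping.lookup \<alpha> j)))"
    by (simp add: D_def pleth_qfun_tilde flip: mult.assoc mps_const_mult)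
  also have "\<dots> = mps_const ((\<qq> - 1) ^ expvec_len \<alpha>) * pleth_prod \<alpha>"
    by (simp add: pleth_prod_def prod.distrib mps_const_power expvec_len_def)
  finally have D: "D = (\<Sum>\<mu>\<in>?S. mps_const (e \<mu>) * Qfun \<mu>)"
    unfolding zeta_expansion True e_def mps_const_mult [of "_ ^ expvec_len \<alpha>"]
    by (simp only: sum_distrib_left mult.assoc)
  have "(\<Sum>\<mu>\<in>?S. mps_const (invert_q (e \<mu>)) * Qfun \<mu>) = mps_map invert_q D"
    by (simp add: D invert_q_mps.hom_sum invert_q_mps.hom_mult invert_q.mps_map_const invert_q_mps_Qfun)
  also have "\<dots> = mps_const ?\<kappa> * D"
    unfolding D_def invert_q_mps_qdiff_prod using True by (simp add: expvec_size_def)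
  also have "\<dots> = (\<Sum>\<mu>\<in>?S. mps_const (?\<kappa> * e \<mu>) * Qfun \<mu>)"
    unfolding D mps_const_mult [of ?\<kappa>] by (simp only: sum_distrib_left mult.assoc)
  finally have sums: "(\<Sum>\<mu>\<in>?S. mps_const (invert_q (e \<mu>)) * Qfun \<mu>) =
      (\<Sum>\<mu>\<in>?S. mps_const (?\<kappa> * e \<mu>) * Qfun \<mu>)" .
  have "invert_q (e \<nu>) = ?\<kappa> * e \<nu>"
    by (rule Qfun_expansion_unique [OF finite_strict_partitions _ sums]) (use assms in \<open>auto simp: strict_partitions_def\<close>)
  moreover have "(\<qq> - 1) ^ expvec_len \<alpha> * zeta \<nu> \<alpha> = two_weight \<nu> * e \<nu>"
    by (simp add: e_def)
  ultimately show ?thesis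
    by (simp add: invert_q.hom_mult invert_q.hom_power invert_q.hom_numeral)
qed

text \<open>If the degree exceeded \<open>d\<close>, then P times a positive power of the variable
  would equal the reversal of P, whose degree is at most that of P.\<close>

lemma palindromic_degree:
  assumes "to_fract P = \<qq> ^ d * eval_inv P"
  shows "degree P \<le> d"
proof (rule ccontr)
  assume "\<not> degree P \<le> d"
  then have d: "d < degree P" by simp
  have "to_fract (monom 1 (degree P - d) * P) = \<qq> ^ (degree P - d) * to_fract P"
    by (simp add: monom_altdef to_fract_pow \<qq>_def)
  also have "\<dots> = \<qq> ^ degree P * eval_inv P"
    using d by (subst assms) (simp flip: mult.assoc power_add)
  also have "\<dots> = to_fract (reflect_poly P)"
    by (rule power_mult_eval_inv_reflect)
  finally have "monom 1 (degree P - d) * P = reflect_poly P"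
    by (simp only: to_fract_eq_iff)
  then have "degree (monom 1 (degree P - d) * P) \<le> degree P"
    using degree_reflect_poly_le by metis
  moreover have "P \<noteq> 0" using d by auto
  ultimately show False
    using d by (simp add: degree_mult_eq degree_monom_eq)
qed

lemma palindromic_coeff:
  assumes "to_fract P = \<qq> ^ d * eval_inv P" and "i \<le> d"
  shows "coeff P i = coeff P (d - i)"
proof -
  let ?R = "\<Sum>i\<le>d. monom (coeff P (d - i)) i"
  have "to_fract P = (\<Sum>i\<le>d. ratfun_const (coeff P (d - i)) * \<qq> ^ i)"
    using assms(1) power_mult_eval_inv [OF palindromic_degree [OF assms(1)]] by simp
  also have "\<dots> = to_fract ?R"
    by (simp add: monom_altdef ratfun_const_def \<qq>_def flip: to_fract_pow to_fract_mult)
  finally have "P = ?R" by (simp only: to_fract_eq_iff)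
  then have "coeff P i = coeff ?R i" by (rule arg_cong)
  also have "\<dots> = coeff P (d - i)"
    using assms(2) by (simp add: coeff_sum if_distrib cong: if_cong)
  finally show ?thesis .
qed

lemma expvec_nth:
  assumes "0 \<notin> set \<rho>"
  shows "expvec_size (Poly_Mapping.nth \<rho>) = sum_list \<rho>" and "expvec_len (Poly_Mapping.nth \<rho>) = length \<rho>"
proof -
  have lookup: "Poly_Mapping.lookup (Poly_Mapping.nth \<rho>) i = (if i < length \<rho> then \<rho> ! i else 0)" for i
    by (simp add: nth_default_def)
  have "\<rho> ! i \<noteq> 0" if "i < length \<rho>" for i
    using assms nth_mem [OF that] by metis
  then have keys: "Poly_Mapping.keys (Poly_Mapping.nth \<rho>) = {..<length \<rho>}"
    by (intro set_eqI) (simp add: in_keys_iff lookup del: lookup_nth keys_nth)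
  show "expvec_len (Poly_Mapping.nth \<rho>) = length \<rho>"
    unfolding expvec_len_def keys by simp
  show "expvec_size (Poly_Mapping.nth \<rho>) = sum_list \<rho>"
    unfolding expvec_size_def keys lookup by (simp add: sum_list_sum_nth atLeast0LessThan)
qed

text \<open>Odd parts make the size and the length congruent mod 2, so the sign in the symmetry of
  \<zeta> is +1.\<close>

lemma odd_partition_parity:
  assumes "odd_partition \<rho>"
  shows "even (sum_list \<rho> - length \<rho>)" and "length \<rho> \<le> sum_list \<rho>"
proof -
  have odd: "\<forall>r\<in>set \<rho>. odd r" using assms by (simp add: odd_partition_def)
  then have "even (sum_list \<rho> + length \<rho>)" by (induction \<rho>) auto
  then show "even (sum_list \<rho> - length \<rho>)" by simp
  show "length \<rho> \<le> sum_list \<rho>"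
    using odd by (intro length_le_sum_list) auto
qed

text \<open>Inversion sends \<open>\<qq> - 1\<close> to
  \<open>- inverse \<qq> * (\<qq> - 1)\<close>. The \<open>length \<rho>\<close> such factors cancel
  against the scalar in degree \<open>n\<close> and leave the exponent
  \<open>n - length \<rho>\<close>.\<close>

lemma zeta_part_palindromic:
  assumes "strict_partition \<nu>" and "sum_list \<nu> = n" and "odd_partition \<rho>" and "sum_list \<rho> = n"
  shows "zeta_part \<nu> \<rho> = \<qq> ^ (n - length \<rho>) * invert_q (zeta_part \<nu> \<rho>)"
proof -
  let ?l = "length \<rho>" and ?z = "zeta_part \<nu> \<rho>"
  define d where "d = n - ?l"
  have n: "n = d + ?l" and "even d"
    using odd_partition_parity [OF assms(3)] assms(4) by (auto simp: d_def)
  have "0 \<notin> set \<rho>"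
    using assms(3) by (auto simp: odd_partition_def)
  then have "invert_q ((\<qq> - 1) ^ ?l * ?z) = (-1) ^ n * inverse \<qq> ^ n * ((\<qq> - 1) ^ ?l * ?z)"
    using invert_q_Gc_coeff [OF assms(1,2), of "Poly_Mapping.nth \<rho>"] by (simp add: expvec_nth)
  moreover have "invert_q (\<qq> - 1) = - inverse \<qq> * (\<qq> - 1)"
    by (simp add: invert_q.hom_diff invert_q.hom_1 field_simps)
  ultimately have "(- inverse \<qq>) ^ ?l * (\<qq> - 1) ^ ?l * invert_q ?z =
      (- inverse \<qq>) ^ n * (\<qq> - 1) ^ ?l * ?z"
    by (simp only: invert_q.hom_mult invert_q.hom_power power_mult_distrib mult.assoc power_minus [of "inverse \<qq>"])
  then have "invert_q ?z = (- inverse \<qq>) ^ d * ?z"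
    by (simp add: n power_add mult_ac)
  then have "\<qq> ^ d * invert_q ?z = ?z"
    using \<open>even d\<close> by (simp add: power_inverse)
  then show ?thesis by (simp add: d_def)
qed

theorem theorem6p17:
  fixes n :: nat and \<nu> :: "nat list"
  assumes "strict_partition \<nu>" and "sum_list \<nu> = n"
  shows "mps_map invert_q (Gc \<nu>) = mps_const ((-1) ^ n * inverse \<qq> ^ n) * Gc \<nu> \<and>
    (\<forall>\<rho>. odd_partition \<rho> \<and> sum_list \<rho> = n \<longrightarrow>
       zeta_part \<nu> \<rho> = \<qq> ^ (n - length \<rho>) * invert_q (zeta_part \<nu> \<rho>) \<and>
       (\<exists>P :: rat poly. zeta_part \<nu> \<rho> = to_fract P \<and> degree P \<le> n - length \<rho>) \<and>
       (\<forall>a :: nat \<Rightarrow> rat. zeta_part \<nu> \<rho> = (\<Sum>i\<le>n - length \<rho>. ratfun_const (a i) * \<qq> ^ i) \<longrightarrow>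
          (\<forall>i\<le>n - length \<rho>. a i = a (n - length \<rho> - i))))"
proof (intro conjI allI impI)
  show "mps_map invert_q (Gc \<nu>) = mps_const ((-1) ^ n * inverse \<qq> ^ n) * Gc \<nu>"
  proof (rule mps_eqI)
    fix \<alpha>
    show "mps_coeff (mps_map invert_q (Gc \<nu>)) \<alpha> =
        mps_coeff (mps_const ((-1) ^ n * inverse \<qq> ^ n) * Gc \<nu>) \<alpha>"
      using invert_q_Gc_coeff [OF assms] by (simp add: mps_map_def Gc_def)
  qed
next
  fix \<rho> assume "odd_partition \<rho> \<and> sum_list \<rho> = n"
  then show sym: "zeta_part \<nu> \<rho> = \<qq> ^ (n - length \<rho>) * invert_q (zeta_part \<nu> \<rho>)"
    using zeta_part_palindromic assms by blast
  have pal: "to_fract P = \<qq> ^ (n - length \<rho>) * eval_inv P" if "zeta_part \<nu> \<rho> = to_fract P" for P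
    using sym unfolding that invert_q_to_fract .
  show "\<exists>P. zeta_part \<nu> \<rho> = to_fract P \<and> degree P \<le> n - length \<rho>"
    using zeta_in_polys [of \<nu> "Poly_Mapping.nth \<rho>"] pal palindromic_degree by blast
  fix a :: "nat \<Rightarrow> rat" and i
  assume a: "zeta_part \<nu> \<rho> = (\<Sum>i\<le>n - length \<rho>. ratfun_const (a i) * \<qq> ^ i)" and i: "i \<le> n - length \<rho>"
  \<comment> \<open>Within the range of summation \<open>a\<close> gives the coefficients of
    \<open>?P\<close> even if the top ones vanish, and \<open>palindromic_coeff\<close> asks only
    for i \<le> d, not for d to be the degree.\<close>
  let ?P = "\<Sum>i\<le>n - length \<rho>. monom (a i) i"
  have coeff: "coeff ?P j = a j" if "j \<le> n - length \<rho>" for j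
    using that by (simp add: coeff_sum if_distrib cong: if_cong)
  have "zeta_part \<nu> \<rho> = to_fract ?P"
    unfolding a by (simp add: monom_altdef ratfun_const_def \<qq>_def flip: to_fract_pow to_fract_mult)
  from palindromic_coeff [OF pal [OF this] i] show "a i = a (n - length \<rho> - i)"
    using i by (simp add: coeff)
qed

end
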